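(* Let $G$ be a locally compact group, let $Z(G)$ be the algebraic center of $G$ and put $\kappa=\kappa(Z(G))$. If $\kappa\neq 1$, then there is a linear isometry $\Psi\colon\ell_\infty(\kappa)\to\mathscr{WAP}(G)/\mathscr{B}(G)$.
   Context: All groups are Hausdorff. The compact covering number $\kappa(X)$ of a topological space $X$ is the smallest cardinal number of compact subsets of $X$ required to cover $X$. $\mathscr{CB}(G)$ is the algebra of bounded continuous complex-valued functions with the supremum norm. $\mathscr{WAP}(G)$ is the algebra of $f\in\mathscr{CB}(G)$ whose set of left translates $\{f_s:s\in G\}$, $f_s(t)=f(st)$, is relatively weakly compact in $\mathscr{CB}(G)$. The Fourier-Stieltjes algebra $B(G)$ is the linear span of the continuous positive definite functions on $G$, and the Eberlein algebra $\mathscr{B}(G)$ is the closure of $B(G)$ in the supremum norm; $\mathscr{B}(G)\subseteq\mathscr{WAP}(G)$. $\ell_\infty(\kappa)$ is the space of bounded complex functions on $\kappa$ with the supremum norm; quotients carry the quotient norm; a linear isometry need not be surjective. *)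

theory Defs
  imports "HOL-Analysis.Analysis"
begin

unbundle cardinal_syntax

text \<open>Groups are written additively, since the library's class of (not necessarily
  commutative) topological groups is \<open>topological_group_add\<close>: the product \<open>st\<close> is \<open>s + t\<close> and
  the inverse of \<open>s\<close> is \<open>- s\<close>. The algebra of bounded continuous complex-valued functions
  on the group, with the supremum norm, is the type \<open>'g \<Rightarrow>\<^sub>C complex\<close>.\<close>

definition group_center :: "'g::group_add set" where
  "group_center = {z. \<forall>g. z + g = g + z}"


subsection \<open>Compact covering number\<close>

definition compact_cover :: "'a topology \<Rightarrow> 'a set set \<Rightarrow> bool" where
  "compact_cover X \<K> \<longleftrightarrow> (\<forall>K\<in>\<K>. compactin X K) \<and> \<Union>\<K> = topspace X"

text \<open>Cardinals are represented, as in the library, by minimal well-orders; the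
  cardinal itself, viewed as an index set, is the field of the well-order. The two lemmas after
  the definition show that the choice is harmless.\<close>

definition compact_covering_number :: "'a topology \<Rightarrow> 'a set rel" where
  "compact_covering_number X =
     |SOME \<K>. compact_cover X \<K> \<and> (\<forall>\<L>. compact_cover X \<L> \<longrightarrow> |\<K>| \<le>o |\<L>| )|"

lemma compact_covering_number_attained_aux:
  "\<exists>\<K>. compact_cover X \<K> \<and> (\<forall>\<L>. compact_cover X \<L> \<longrightarrow> |\<K>| \<le>o |\<L>| )"
proof -
  let ?R = "card_of ` {\<K>. compact_cover X \<K>}"
  have "compact_cover X ((\<lambda>x. {x}) ` topspace X)"
    by (auto simp: compact_cover_def)
  then have "?R \<noteq> {}" by blast
  moreover have "\<forall>r\<in>?R. Card_order r"
    by (auto simp: card_of_Card_order)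
  ultimately obtain r where "r \<in> ?R" "\<forall>r'\<in>?R. r \<le>o r'"
    using exists_minim_Card_order[of ?R] by blast
  then show ?thesis by blast
qed

lemma compact_covering_number_attained:
  "\<exists>\<K>. compact_cover X \<K> \<and> compact_covering_number X = |\<K>|"
  using someI_ex[OF compact_covering_number_attained_aux[of X]]
  unfolding compact_covering_number_def by blast

lemma compact_covering_number_le:
  "compact_cover X \<L> \<Longrightarrow> compact_covering_number X \<le>o |\<L>|"
  using someI_ex[OF compact_covering_number_attained_aux[of X]]
  unfolding compact_covering_number_def by blast


subsection \<open>Complex scalar multiplication and the weak topology\<close>

context includes bcontfun.lifting
begin

lift_definition cscale ::
  "complex \<Rightarrow> ('a::topological_space \<Rightarrow>\<^sub>C complex) \<Rightarrow> ('a \<Rightarrow>\<^sub>C complex)"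
  is "\<lambda>c f x. c * f x"
  using bounded_linear_image[OF _ bounded_linear_mult_right]
  by (fastforce simp: bcontfun_def image_image intro!: continuous_intros)

lift_definition left_translate ::
  "'g::topological_group_add \<Rightarrow> ('g \<Rightarrow>\<^sub>C complex) \<Rightarrow> ('g \<Rightarrow>\<^sub>C complex)"
  is "\<lambda>s f t. f (s + t)"
  by (auto simp: bcontfun_def intro!: continuous_intros
      elim!: continuous_on_compose2 bounded_subset)

end

lemma vector_space_cscale: "vector_space cscale"
  by unfold_locales (auto intro!: bcontfun_eqI simp: cscale.rep_eq algebra_simps)

definition weak_topology :: "('a::topological_space \<Rightarrow>\<^sub>C complex) topology" where
  "weak_topology = topology_generated_by
     {\<phi> -` U | (\<phi> :: ('a \<Rightarrow>\<^sub>C complex) \<Rightarrow> complex) U.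
        bounded_linear \<phi> \<and> (\<forall>c f. \<phi> (cscale c f) = c * \<phi> f) \<and> open U}"

definition relatively_weakly_compact :: "('a::topological_space \<Rightarrow>\<^sub>C complex) set \<Rightarrow> bool" where
  "relatively_weakly_compact A \<longleftrightarrow> compactin weak_topology (weak_topology closure_of A)"


subsection \<open>The function algebras\<close>

definition WAP :: "('g::topological_group_add \<Rightarrow>\<^sub>C complex) set" where
  "WAP = {f. relatively_weakly_compact (range (\<lambda>s. left_translate s f))}"

definition positive_definite :: "('g::group_add \<Rightarrow> complex) \<Rightarrow> bool" where
  "positive_definite \<phi> \<longleftrightarrow> (\<forall>n (x :: nat \<Rightarrow> 'g) (c :: nat \<Rightarrow> complex).
     (\<Sum>i<n. \<Sum>j<n. cnj (c i) * c j * \<phi> (- x i + x j)) \<in> \<real>\<^sub>\<ge>\<^sub>0)"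

lemma positive_definite_bound:
  fixes \<phi> :: "'g::group_add \<Rightarrow> complex"
  assumes "positive_definite \<phi>"
  shows "cmod (\<phi> x) \<le> Re (\<phi> 0)"
proof -
  have pd: "cnj a * a * \<phi> 0 + cnj a * b * \<phi> x + (cnj b * a * \<phi> (- x) + cnj b * b * \<phi> 0) \<in> \<real>\<^sub>\<ge>\<^sub>0"
    for a b
    using assms[unfolded positive_definite_def, rule_format, where n = 2
        and x = "\<lambda>i. if i = 0 then 0 else x" and c = "\<lambda>i. if i = 0 then a else b"]
    by (simp add: numeral_2_eq_2)
  have z: "Im (\<phi> 0) = 0" using pd[of 1 0] by (simp add: complex_nonneg_Reals_iff)
  have 1: "Im (\<phi> (- x)) = - Im (\<phi> x)"
    using pd[of 1 1] z by (simp add: complex_nonneg_Reals_iff)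
  have 2: "Re (\<phi> (- x)) = Re (\<phi> x)"
    using pd[of 1 \<i>] z by (simp add: complex_nonneg_Reals_iff)
  have m: "\<phi> (- x) = cnj (\<phi> x)" using 1 2 by (simp add: complex_eq_iff)
  show ?thesis
  proof (cases "\<phi> x = 0")
    case True
    then show ?thesis using pd[of 1 0] by (simp add: complex_nonneg_Reals_iff)
  next
    case False
    define b where "b = - cnj (sgn (\<phi> x))"
    have s: "cnj (sgn (\<phi> x)) * \<phi> x = of_real (cmod (\<phi> x))"
      using False by (simp add: sgn_eq complex_norm_square[symmetric] field_simps power2_eq_square
          flip: of_real_mult)
    have s': "sgn (\<phi> x) * cnj (\<phi> x) = of_real (cmod (\<phi> x))"
      using arg_cong[OF s, of cnj] by simp
    have "sgn (\<phi> x) * cnj (sgn (\<phi> x)) = 1"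
      using False by (simp add: complex_norm_square[symmetric] norm_sgn)
    then show ?thesis
      using pd[of 1 b] by (simp add: b_def m s s' complex_nonneg_Reals_iff)
  qed
qed

lemma continuous_positive_definite_in_bcontfun:
  fixes \<phi> :: "'g::topological_group_add \<Rightarrow> complex"
  assumes "continuous_on UNIV \<phi>" "positive_definite \<phi>"
  shows "\<phi> \<in> bcontfun"
  using assms by (blast intro: bcontfun_normI positive_definite_bound)

text \<open>By the preceding lemma, every continuous positive definite function occurs among
  the generators of the following span.\<close>

definition Fourier_Stieltjes :: "('g::topological_group_add \<Rightarrow>\<^sub>C complex) set" where
  "Fourier_Stieltjes = module.span cscale {f. positive_definite (apply_bcontfun f)}"

definition Eberlein :: "('g::topological_group_add \<Rightarrow>\<^sub>C complex) set" where
  "Eberlein = closure Fourier_Stieltjes"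


subsection \<open>Quotients\<close>

text \<open>Elements of \<open>V / W\<close> are the cosets \<open>f +o W\<close> with \<open>f \<in> V\<close>, and addition of cosets is
  the elementwise sum \<open>C + D\<close> of \<open>HOL-Library.Set_Algebras\<close>. In the scalar multiplication the
  summand \<open>W\<close> only matters for the scalar \<open>0\<close>, where the elementwise
  multiple would be \<open>{0}\<close> instead of \<open>W\<close>.\<close>

definition quotient_space ::
  "('a::topological_space \<Rightarrow>\<^sub>C complex) set \<Rightarrow> ('a \<Rightarrow>\<^sub>C complex) set \<Rightarrow> ('a \<Rightarrow>\<^sub>C complex) set set" where
  "quotient_space V W = (\<lambda>f. f +o W) ` V"

definition quotient_scale ::
  "('a::topological_space \<Rightarrow>\<^sub>C complex) set \<Rightarrow> complex \<Rightarrow> ('a \<Rightarrow>\<^sub>C complex) set \<Rightarrow> ('a \<Rightarrow>\<^sub>C complex) set" where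
  "quotient_scale W c C = cscale c ` C + W"

definition quotient_norm :: "('a::topological_space \<Rightarrow>\<^sub>C complex) set \<Rightarrow> real" where
  "quotient_norm C = (INF f\<in>C. norm f)"

lemma coset_add:
  assumes "module.subspace cscale W"
  shows "(f +o W) + (g +o W) = (f + g) +o W"
proof -
  interpret vector_space cscale by (rule vector_space_cscale)
  have "W + W = W"
    using subspace_add[OF assms] subspace_0[OF assms] by (force simp: set_plus_def)
  then show ?thesis
    by (metis set_plus_rearrange)
qed

lemma quotient_scale_coset:
  assumes "module.subspace cscale W"
  shows "quotient_scale W c (f +o W) = cscale c f +o W"
proof -
  interpret vector_space cscale by (rule vector_space_cscale)
  have "cscale c f + cscale c w + w' \<in> cscale c f +o W" if "w \<in> W" "w' \<in> W" for w w'
    using that subspace_add[OF assms] subspace_scale[OF assms]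
    by (auto simp: elt_set_plus_def add.assoc)
  moreover have "cscale c f + w \<in> quotient_scale W c (f +o W)" if "w \<in> W" for w
    unfolding quotient_scale_def
    using that subspace_0[OF assms] by (intro set_plus_intro) (force simp: elt_set_plus_def)+
  ultimately show ?thesis
    by (auto simp: quotient_scale_def elt_set_plus_def scale_right_distrib elim!: set_plus_elim)
qed


subsection \<open>Bounded functions on an index set\<close>

text \<open>A function on \<open>I\<close> is represented by its extension by \<open>0\<close>; hence the supremum over all
  indices below is the supremum over \<open>I\<close> (and \<open>0\<close> if \<open>I\<close> is empty).\<close>

definition linfty :: "'i set \<Rightarrow> ('i \<Rightarrow> complex) set" where
  "linfty I = {x. bounded (range x) \<and> (\<forall>i. i \<notin> I \<longrightarrow> x i = 0)}"

definition linfty_norm :: "('i \<Rightarrow> complex) \<Rightarrow> real" where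
  "linfty_norm x = (SUP i. cmod (x i))"

end

theory Submission
  imports Defs
begin

text \<open>Write \<open>Z\<close> for the centre. If \<open>\<kappa>\<close> is not \<open>1\<close> then \<open>Z\<close> is not compact and \<open>\<kappa>\<close> is infinite.
  The isometry sends a bounded function \<open>x\<close> on \<open>\<kappa>\<close> to the class of a sum of disjoint bumps: for
  each index \<open>\<alpha>\<close> and each \<open>n\<close> there is a grid of \<open>n \<times> n\<close> central points \<open>a i + b j\<close>, and the
  bump at such a point has height \<open>x \<alpha>\<close> times the entry \<open>(i, j)\<close> of the Fourier matrix of size \<open>n\<close>.
  The sum \<open>f\<close> depends linearly on \<open>x\<close> and its norm is at most that of \<open>x\<close>. Two things remain.

  First, no function of the Eberlein algebra is closer to \<open>f\<close> than \<open>\<bar>x \<alpha>\<bar>\<close>, for any \<open>\<alpha>\<close>. The Fourier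
  matrix has \<open>n\<^sup>2\<close> unimodular entries but operator norm \<open>sqrt n\<close>, and on a grid \<open>a i + b j\<close> a
  positive definite function is a matrix of inner products. Therefore the average of a function of
  \<open>B(G)\<close> against the conjugate Fourier matrix over the grid of size \<open>n\<close> tends to zero, while the
  average of \<open>f\<close> is \<open>x \<alpha>\<close> (lemma \<open>Eberlein_distance\<close>).

  Second, \<open>f\<close> is weakly almost periodic if the grid points are generic enough: the difference
  lies in a given compact set for only finitely many pairs of distinct grid points. Then two translates
  of \<open>f\<close> by elements far apart share finitely many bumps only, and along a sequence of
  translations that runs away from all compact sets, a translate is a single bump plus two
  functions each of which has support disjoint from its predecessors. A bounded
  sequence of functions with disjoint supports is weakly null, so the new weak limits of the orbit
  are scaled translates of one bump (lemma \<open>bump_series_in_WAP\<close>).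

  Generic grids come from generators chosen by transfinite recursion of length \<open>\<kappa>\<close>, each outside the
  translates of a fixed compact set \<open>K\<close> by short signed sums of earlier generators. These are fewer
  than \<open>\<kappa>\<close> compact sets, hence they do not cover \<open>Z\<close> (lemmas \<open>separated_grid_exists\<close> and
  \<open>small_translates_not_cover\<close>).\<close>


section \<open>Fourier matrices and the Eberlein algebra\<close>

definition fourier_matrix :: "nat \<Rightarrow> nat \<Rightarrow> nat \<Rightarrow> complex" where
  "fourier_matrix n i j = cis (2 * pi * real i * real j / real n)"

lemma norm_fourier_matrix [simp]: "cmod (fourier_matrix n i j) = 1"
  by (simp add: fourier_matrix_def)

lemma cnj_mult_fourier_matrix [simp]: "cnj (fourier_matrix n i j) * fourier_matrix n i j = 1"
  by (metis complex_norm_square mult.commute norm_fourier_matrix of_real_1 power_one)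

lemma fourier_matrix_orthogonal:
  assumes "j < n" "k < n"
  shows "(\<Sum>i<n. cnj (fourier_matrix n i j) * fourier_matrix n i k) = (if j = k then of_nat n else 0)"
proof (cases "j = k")
  case False
  define z where "z = cis (2 * pi * (real k - real j) / real n)"
  have n: "n > 0" using assms by simp
  have pow: "cnj (fourier_matrix n i j) * fourier_matrix n i k = z ^ i" for i
  proof -
    have "cnj (fourier_matrix n i j) * fourier_matrix n i k
        = cis (real i * (2 * pi * (real k - real j) / real n))"
      unfolding fourier_matrix_def
      by (simp add: cis_cnj cis_mult) (simp add: algebra_simps diff_divide_distrib)
    then show ?thesis by (simp only: z_def Complex.DeMoivre)
  qed
  have "z \<noteq> 1"
  proof
    assume "z = 1"
    then have "cos (2 * pi * (real k - real j) / real n) = 1"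
      unfolding z_def by (metis cis.sel(1) one_complex.sel(1))
    then obtain m :: int where "2 * pi * (real k - real j) / real n = real_of_int m * 2 * pi"
      using cos_one_2pi_int by blast
    then have "pi * (real k - real j) = pi * (real_of_int m * real n)"
      using n by (simp add: field_simps)
    then have "real k - real j = real_of_int m * real n" by simp
    then have "real_of_int (int k - int j) = real_of_int (m * int n)" by simp
    then have km: "int k - int j = m * int n"
      by (simp only: of_int_eq_iff)
    then have "\<bar>m * int n\<bar> < int n" using assms by linarith
    then have "m = 0"
      using n by (simp add: abs_mult)
    then show False using km False by simp
  qed
  moreover have "z ^ n = 1"
  proof -
    have "z ^ n = cis (2 * pi * (real k - real j))"
      using n unfolding z_def by (simp add: Complex.DeMoivre)
    also have "\<dots> = cis (2 * pi * of_int (int k - int j))" by simp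
    also have "\<dots> = 1" by (rule cis_multiple_2pi) simp
    finally show ?thesis .
  qed
  ultimately show ?thesis
    using False by (simp add: pow sum_gp_strict)
qed simp

lemma nonneg_Reals_sum:
  fixes f :: "'a \<Rightarrow> 'b::real_algebra_1"
  shows "(\<And>i. i \<in> A \<Longrightarrow> f i \<in> \<real>\<^sub>\<ge>\<^sub>0) \<Longrightarrow> sum f A \<in> \<real>\<^sub>\<ge>\<^sub>0"
  by (induction A rule: infinite_finite_induct) auto

text \<open>The Fourier matrix is unimodular, so its entries have absolute sum \<open>n\<^sup>2\<close>, but its operator
  norm is only \<open>sqrt n\<close>. A positive definite \<open>\<phi>\<close> is a matrix coefficient, that is
  \<open>\<phi> (a i + b j)\<close> is an inner product of a vector depending on \<open>j\<close> with a vector depending on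
  \<open>i\<close>, all of squared length \<open>\<phi> 0\<close>; hence the operator norm governs its pairing with the matrix.
  Concretely, for each \<open>i\<close> the defining inequality is applied to the points
  \<open>- a i, b 0, \<dots>, b (n - 1)\<close>, and the sum over \<open>i\<close> collapses by orthogonality of the columns
  to an inequality that is quadratic in the coefficient \<open>t\<close> of the first point.\<close>

lemma positive_definite_fourier_bound:
  fixes \<phi> :: "'g::group_add \<Rightarrow> complex"
  assumes pd: "positive_definite \<phi>"
  shows "cmod (\<Sum>i<n. \<Sum>j<n. cnj (fourier_matrix n i j) * \<phi> (a i + b j))
    \<le> real n * sqrt (real n) * Re (\<phi> 0)"
proof (cases "n = 0")
  case False
  let ?e = "fourier_matrix n"
  define S where "S = (\<Sum>i<n. \<Sum>j<n. cnj (?e i j) * \<phi> (a i + b j))"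
  define S' where "S' = (\<Sum>i<n. \<Sum>j<n. ?e i j * \<phi> (- b j + - a i))"
  have form: "cnj t * t * of_nat n * \<phi> 0 + (cnj t * S + t * S') + of_nat n * of_nat n * \<phi> 0 \<in> \<real>\<^sub>\<ge>\<^sub>0" for t
  proof -
    have 1: "cnj t * t * \<phi> 0 + (cnj t * (\<Sum>j<n. cnj (?e i j) * \<phi> (a i + b j)) + t * (\<Sum>j<n. ?e i j * \<phi> (- b j + - a i)))
       + (\<Sum>j<n. \<Sum>k<n. ?e i j * cnj (?e i k) * \<phi> (- b j + b k)) \<in> \<real>\<^sub>\<ge>\<^sub>0" for i
    proof -
      define x where "x k = (case k of 0 \<Rightarrow> - a i | Suc j \<Rightarrow> b j)" for k
      define c where "c k = (case k of 0 \<Rightarrow> t | Suc j \<Rightarrow> cnj (?e i j))" for k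
      have "(\<Sum>k<Suc n. \<Sum>l<Suc n. cnj (c k) * c l * \<phi> (- x k + x l)) \<in> \<real>\<^sub>\<ge>\<^sub>0"
        using pd unfolding positive_definite_def by blast
      also have "(\<Sum>k<Suc n. \<Sum>l<Suc n. cnj (c k) * c l * \<phi> (- x k + x l)) =
        cnj t * t * \<phi> 0 + (cnj t * (\<Sum>j<n. cnj (?e i j) * \<phi> (a i + b j)) + t * (\<Sum>j<n. ?e i j * \<phi> (- b j + - a i)))
         + (\<Sum>j<n. \<Sum>k<n. ?e i j * cnj (?e i k) * \<phi> (- b j + b k))"
        by (simp add: sum.lessThan_Suc_shift x_def c_def sum.distrib sum_distrib_left algebra_simps
            del: sum.lessThan_Suc)
      finally show ?thesis .
    qed
    have "(\<Sum>i<n. \<Sum>j<n. \<Sum>k<n. ?e i j * cnj (?e i k) * \<phi> (- b j + b k)) =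
       (\<Sum>j<n. \<Sum>i<n. \<Sum>k<n. ?e i j * cnj (?e i k) * \<phi> (- b j + b k))"
      by (rule sum.swap)
    also have "\<dots> = (\<Sum>j<n. \<Sum>k<n. \<Sum>i<n. ?e i j * cnj (?e i k) * \<phi> (- b j + b k))"
      by (rule sum.cong[OF refl], rule sum.swap)
    also have "\<dots> = (\<Sum>j<n. \<Sum>k<n. (\<Sum>i<n. cnj (?e i k) * ?e i j) * \<phi> (- b j + b k))"
      by (simp add: sum_distrib_left mult_ac)
    also have "\<dots> = (\<Sum>j<n. \<Sum>k<n. if k = j then of_nat n * \<phi> 0 else 0)"
      by (intro sum.cong refl) (simp add: fourier_matrix_orthogonal)
    also have "\<dots> = of_nat n * of_nat n * \<phi> 0"
      by simp
    finally have 2: "(\<Sum>i<n. \<Sum>j<n. \<Sum>k<n. ?e i j * cnj (?e i k) * \<phi> (- b j + b k)) = of_nat n * of_nat n * \<phi> 0" .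
    have "(\<Sum>i<n. cnj t * t * \<phi> 0 + (cnj t * (\<Sum>j<n. cnj (?e i j) * \<phi> (a i + b j)) + t * (\<Sum>j<n. ?e i j * \<phi> (- b j + - a i)))
       + (\<Sum>j<n. \<Sum>k<n. ?e i j * cnj (?e i k) * \<phi> (- b j + b k))) \<in> \<real>\<^sub>\<ge>\<^sub>0"
      by (intro nonneg_Reals_sum 1)
    also have "(\<Sum>i<n. cnj t * t * \<phi> 0 + (cnj t * (\<Sum>j<n. cnj (?e i j) * \<phi> (a i + b j)) + t * (\<Sum>j<n. ?e i j * \<phi> (- b j + - a i)))
       + (\<Sum>j<n. \<Sum>k<n. ?e i j * cnj (?e i k) * \<phi> (- b j + b k))) =
       cnj t * t * of_nat n * \<phi> 0 + (cnj t * S + t * S') + of_nat n * of_nat n * \<phi> 0"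
      by (simp only: sum.distrib 2 sum_distrib_left[symmetric] S_def[symmetric] S'_def[symmetric])
        (simp add: algebra_simps)
    finally show ?thesis .
  qed
  have pos: "Re (\<phi> 0) \<ge> 0"
    using positive_definite_bound[OF pd, of 0] norm_ge_zero order_trans by blast
  have im: "Im (\<phi> 0) = 0"
    using form[of 0] False by (auto simp: complex_nonneg_Reals_iff)
  have S': "S' = cnj S"
    using form[of 1] form[of "\<i>"] im by (auto simp: complex_nonneg_Reals_iff complex_eq_iff)
  show ?thesis
  proof (cases "S = 0")
    case True
    then show ?thesis using pos by (simp flip: S_def)
  next
    case nz: False
    \<comment> \<open>The optimal \<open>t\<close> has modulus \<open>sqrt n\<close> and the phase that turns \<open>cnj t * S\<close> into a
      negative number.\<close>
    define r where "r = sqrt (real n)"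
    have r: "r > 0" "r * r = real n" using False by (auto simp: r_def)
    define t where "t = - of_real r * sgn S"
    have tt: "cnj t * t = of_real (r * r)"
    proof -
      have "cnj t * t = of_real (r * r) * (sgn S * cnj (sgn S))" by (simp add: t_def)
      also have "sgn S * cnj (sgn S) = 1"
        using nz by (simp add: complex_norm_square[symmetric] norm_sgn)
      finally show ?thesis by simp
    qed
    have tS: "cnj t * S = - of_real (r * cmod S)"
    proof -
      have "cnj (sgn S) * S = of_real (cmod S)"
        using nz by (simp add: sgn_eq complex_norm_square[symmetric] field_simps power2_eq_square
            flip: of_real_mult)
      moreover have "cnj t * S = - of_real r * (cnj (sgn S) * S)"
        by (simp add: t_def)
      ultimately show ?thesis by simp
    qed
    have tS': "t * S' = - of_real (r * cmod S)"
      using arg_cong[OF tS, of cnj] by (simp add: S' mult.commute)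
    have "0 \<le> r * r * real n * Re (\<phi> 0) - 2 * (r * cmod S) + real n * real n * Re (\<phi> 0)"
      using form[of t] unfolding tt tS tS' by (simp add: complex_nonneg_Reals_iff im)
    moreover have "r * (real n * r * Re (\<phi> 0)) = real n * real n * Re (\<phi> 0)"
      by (simp add: mult_ac flip: r(2))
    ultimately have "r * cmod S \<le> r * (real n * r * Re (\<phi> 0))"
      unfolding r(2) by linarith
    then have "cmod S \<le> real n * r * Re (\<phi> 0)"
      using r(1) by (rule mult_left_le_imp_le)
    then show ?thesis by (simp add: S_def r_def)
  qed
qed simp

interpretation bcf: vector_space "cscale :: complex \<Rightarrow> ('g::topological_space \<Rightarrow>\<^sub>C complex) \<Rightarrow> _"
  by (rule vector_space_cscale)

lemma norm_cscale_le: "norm (cscale c f) \<le> cmod c * norm f"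
  by (rule norm_bound) (simp add: cscale.rep_eq norm_mult mult_left_mono norm_bounded)

lemma bounded_linear_cscale: "bounded_linear (cscale c)"
proof (rule bounded_linear_intro[where K = "cmod c"])
  show "norm (cscale c f) \<le> norm f * cmod c" for f :: "'a \<Rightarrow>\<^sub>C complex"
    using norm_cscale_le[of c f] by (simp add: mult.commute)
qed (auto intro!: bcontfun_eqI simp: cscale.rep_eq plus_bcontfun.rep_eq scaleR_bcontfun.rep_eq algebra_simps)

text \<open>By linearity the growth rate \<open>n * sqrt n\<close> persists on the whole Fourier-Stieltjes algebra;
  the constant is the one of a representation of \<open>\<phi>\<close> as a linear combination, and it does not
  depend on the grids.\<close>

lemma Fourier_Stieltjes_fourier_bound:
  fixes \<phi> :: "'g::topological_group_add \<Rightarrow>\<^sub>C complex"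
  assumes "\<phi> \<in> Fourier_Stieltjes"
  shows "\<exists>C. \<forall>n a b. cmod (\<Sum>i<n. \<Sum>j<n. cnj (fourier_matrix n i j) * \<phi> (a i + b j))
    \<le> real n * sqrt (real n) * C"
  using assms unfolding Fourier_Stieltjes_def
proof (induction rule: bcf.span_induct_alt)
  case base
  then show ?case by (intro exI[of _ 0]) (simp add: zero_bcontfun.rep_eq)
next
  case (step c f g)
  let ?S = "\<lambda>n a b f. \<Sum>i<n. \<Sum>j<n. cnj (fourier_matrix n i j) * apply_bcontfun f (a i + b j)"
  obtain C where C: "\<And>n a b. cmod (?S n a b g) \<le> real n * sqrt (real n) * C"
    using step by blast
  have "cmod (?S n a b (cscale c f + g)) \<le> real n * sqrt (real n) * (cmod c * Re (f 0) + C)" for n a b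
  proof -
    have "?S n a b (cscale c f + g) = c * ?S n a b f + ?S n a b g"
      by (simp add: plus_bcontfun.rep_eq cscale.rep_eq distrib_left sum.distrib sum_distrib_left mult_ac)
    then have "cmod (?S n a b (cscale c f + g)) \<le> cmod c * cmod (?S n a b f) + cmod (?S n a b g)"
      using norm_triangle_ineq[of "c * ?S n a b f" "?S n a b g"] by (simp only: norm_mult)
    also have "\<dots> \<le> cmod c * (real n * sqrt (real n) * Re (f 0)) + real n * sqrt (real n) * C"
      using step by (intro add_mono mult_left_mono positive_definite_fourier_bound C) auto
    finally show ?thesis by (simp only: distrib_left mult_ac)
  qed
  then show ?case by (intro exI allI)
qed

lemma Eberlein_subspace: "module.subspace cscale (Eberlein :: ('g::topological_group_add \<Rightarrow>\<^sub>C complex) set)"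
  unfolding bcf.subspace_def
proof (intro conjI ballI allI)
  show "0 \<in> (Eberlein :: ('g \<Rightarrow>\<^sub>C complex) set)"
    unfolding Eberlein_def Fourier_Stieltjes_def by (rule subsetD[OF closure_subset bcf.span_zero])
next
  fix f g :: "'g \<Rightarrow>\<^sub>C complex"
  assume "f \<in> Eberlein" "g \<in> Eberlein"
  then obtain u v where "\<And>n. u n \<in> Fourier_Stieltjes" "u \<longlonglongrightarrow> f" "\<And>n. v n \<in> Fourier_Stieltjes" "v \<longlonglongrightarrow> g"
    unfolding Eberlein_def closure_sequential by blast
  then have "\<And>n. u n + v n \<in> Fourier_Stieltjes" "(\<lambda>n. u n + v n) \<longlonglongrightarrow> f + g"
    by (auto simp: Fourier_Stieltjes_def intro: bcf.span_add tendsto_add)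
  then show "f + g \<in> Eberlein"
    unfolding Eberlein_def closure_sequential by (intro exI[of _ "\<lambda>n. u n + v n"]) simp
next
  fix c and f :: "'g \<Rightarrow>\<^sub>C complex"
  assume "f \<in> Eberlein"
  then obtain u where "\<And>n. u n \<in> Fourier_Stieltjes" "u \<longlonglongrightarrow> f"
    unfolding Eberlein_def closure_sequential by blast
  then have "\<And>n. cscale c (u n) \<in> Fourier_Stieltjes" "(\<lambda>n. cscale c (u n)) \<longlonglongrightarrow> cscale c f"
    by (auto simp: Fourier_Stieltjes_def intro: bcf.span_scale bounded_linear.tendsto[OF bounded_linear_cscale])
  then show "cscale c f \<in> Eberlein"
    unfolding Eberlein_def closure_sequential by (intro exI[of _ "\<lambda>n. cscale c (u n)"]) simp
qed

text \<open>A function that equals \<open>x\<close> times the Fourier matrix on an \<open>n \<times> n\<close> grid has pairing of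
  modulus \<open>n\<^sup>2 * \<bar>x\<bar>\<close> with the conjugate matrix, while a function of the Fourier-Stieltjes algebra
  only reaches \<open>C * n * sqrt n\<close>. Comparing the averages for \<open>n\<close> tending to infinity shows that
  nothing in the algebra, hence nothing in its closure, is closer than \<open>\<bar>x\<bar>\<close>.\<close>

lemma Eberlein_distance:
  fixes f :: "'g::topological_group_add \<Rightarrow>\<^sub>C complex"
  assumes grid: "\<And>n i j. i < n \<Longrightarrow> j < n \<Longrightarrow> f (a n i + b n j) = x * fourier_matrix n i j"
    and w: "w \<in> Eberlein"
  shows "cmod x \<le> norm (f + w)"
proof -
  have fs: "cmod x \<le> norm (f + v)" if v: "v \<in> Fourier_Stieltjes" for v
  proof -
    let ?S = "\<lambda>n h. \<Sum>i<n. \<Sum>j<n. cnj (fourier_matrix n i j) * apply_bcontfun h (a n i + b n j)"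
    obtain C where C: "\<And>n. cmod (?S n v) \<le> real n * sqrt (real n) * C"
      using Fourier_Stieltjes_fourier_bound[OF v] by meson
    have bound: "cmod x \<le> norm (f + v) + C / sqrt (real n)" if n: "n > 0" for n
    proof -
      have "?S n f = (\<Sum>i<n. \<Sum>j<n. x)"
        by (intro sum.cong refl) (simp add: grid mult.left_commute)
      then have Sf: "?S n f = of_nat n * of_nat n * x" by simp
      have "?S n (f + v) = ?S n f + ?S n v"
        by (simp add: plus_bcontfun.rep_eq distrib_left sum.distrib)
      then have "real n * real n * cmod x = cmod (?S n (f + v) - ?S n v)"
        by (simp add: Sf norm_mult)
      also have "\<dots> \<le> cmod (?S n (f + v)) + cmod (?S n v)"
        by (rule norm_triangle_ineq4)
      also have "cmod (?S n (f + v)) \<le> (\<Sum>i<n. \<Sum>j<n. norm (f + v))"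
        by (intro sum_norm_le) (use norm_bounded[of "f + v"] in \<open>simp add: norm_mult\<close>)
      finally have "real n * real n * cmod x \<le> real n * real n * norm (f + v) + real n * sqrt (real n) * C"
        using C[of n] by simp
      also have "\<dots> = real n * real n * (norm (f + v) + C / sqrt (real n))"
        using n by (simp add: field_simps)
      finally show ?thesis using n by simp
    qed
    have "(\<lambda>n. norm (f + v) + C / sqrt (real n)) \<longlonglongrightarrow> norm (f + v) + 0"
      by (intro tendsto_intros tendsto_divide_0[OF tendsto_const] filterlim_at_top_imp_at_infinity
          filterlim_compose[OF sqrt_at_top filterlim_real_sequentially])
    then show ?thesis
      using bound by (intro LIMSEQ_le_const[of _ "norm (f + v)"]) (auto intro!: exI[of _ 1])
  qed
  obtain v where v: "\<And>n. v n \<in> Fourier_Stieltjes" "v \<longlonglongrightarrow> w"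
    using w unfolding Eberlein_def closure_sequential by blast
  have "(\<lambda>n. norm (f + v n)) \<longlonglongrightarrow> norm (f + w)"
    by (intro tendsto_intros v)
  then show ?thesis
    by (rule LIMSEQ_le_const) (intro exI[of _ 0] allI impI fs v(1))
qed


section \<open>Weak compactness of sets of bounded functions\<close>

definition cfunctional :: "(('a::topological_space \<Rightarrow>\<^sub>C complex) \<Rightarrow> complex) \<Rightarrow> bool" where
  "cfunctional \<phi> \<longleftrightarrow> bounded_linear \<phi> \<and> (\<forall>c f. \<phi> (cscale c f) = c * \<phi> f)"

definition weak_nhd :: "(('a::topological_space \<Rightarrow>\<^sub>C complex) \<Rightarrow> complex) set \<Rightarrow> real \<Rightarrow>
    ('a \<Rightarrow>\<^sub>C complex) \<Rightarrow> ('a \<Rightarrow>\<^sub>C complex) set" where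
  "weak_nhd \<Phi> e f = {g. \<forall>\<phi>\<in>\<Phi>. cmod (\<phi> g - \<phi> f) < e}"

lemma openin_weak_topology_iff:
  "openin weak_topology = generate_topology_on
     {\<phi> -` U | (\<phi> :: ('a::topological_space \<Rightarrow>\<^sub>C complex) \<Rightarrow> complex) U. cfunctional \<phi> \<and> open U}"
proof -
  have *: "(weak_topology :: ('a \<Rightarrow>\<^sub>C complex) topology) = topology_generated_by {\<phi> -` U | \<phi> U. cfunctional \<phi> \<and> open U}"
    unfolding weak_topology_def cfunctional_def by (simp add: conj_assoc)
  show ?thesis
    unfolding * by (intro ext openin_topology_generated_by_iff)
qed

lemma openin_weak_vimage: "cfunctional \<phi> \<Longrightarrow> open U \<Longrightarrow> openin weak_topology (\<phi> -` U)"
  unfolding openin_weak_topology_iff by (rule generate_topology_on.Basis) blast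

lemma cfunctional_zero: "cfunctional (\<lambda>f. 0)"
  by (simp add: cfunctional_def)

lemma topspace_weak_topology [simp]:
  "topspace (weak_topology :: ('a::topological_space \<Rightarrow>\<^sub>C complex) topology) = UNIV"
proof -
  have "openin weak_topology ((\<lambda>f :: 'a \<Rightarrow>\<^sub>C complex. 0 :: complex) -` UNIV)"
    by (rule openin_weak_vimage[OF cfunctional_zero]) simp
  then show ?thesis
    using openin_subset by auto
qed

text \<open>The finite intersections of subbasic sets can be traded for neighbourhoods given by finitely
  many functionals and one radius; only these are used below.\<close>

lemma openin_weak_imp_nhd:
  assumes "openin weak_topology W" "f \<in> W"
  shows "\<exists>\<Phi> e. finite \<Phi> \<and> (\<forall>\<phi>\<in>\<Phi>. cfunctional \<phi>) \<and> e > 0 \<and> weak_nhd \<Phi> e f \<subseteq> W"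
  using assms unfolding openin_weak_topology_iff
proof (induction rule: generate_topology_on.induct)
  case (Int a b)
  from Int.prems Int.IH(1) obtain \<Phi> e
    where 1: "finite \<Phi>" "\<forall>\<phi>\<in>\<Phi>. cfunctional \<phi>" "e > 0" "weak_nhd \<Phi> e f \<subseteq> a" by auto
  from Int.prems Int.IH(2) obtain \<Phi>' e'
    where 2: "finite \<Phi>'" "\<forall>\<phi>\<in>\<Phi>'. cfunctional \<phi>" "e' > 0" "weak_nhd \<Phi>' e' f \<subseteq> b" by auto
  have "weak_nhd (\<Phi> \<union> \<Phi>') (min e e') f \<subseteq> weak_nhd \<Phi> e f \<inter> weak_nhd \<Phi>' e' f"
    unfolding weak_nhd_def by auto
  with 1 2 show ?case
    by (intro exI[of _ "\<Phi> \<union> \<Phi>'"] exI[of _ "min e e'"]) auto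
next
  case (UN K)
  then obtain k where k: "k \<in> K" "f \<in> k" by blast
  from UN.IH[OF this] obtain \<Phi> e
    where "finite \<Phi>" "\<forall>\<phi>\<in>\<Phi>. cfunctional \<phi>" "e > 0" "weak_nhd \<Phi> e f \<subseteq> k" by auto
  with k show ?case by (intro exI[of _ \<Phi>] exI[of _ e]) auto
next
  case (Basis s)
  then obtain \<phi> U where s: "s = \<phi> -` U" "cfunctional \<phi>" "open U" by blast
  then obtain e where "e > 0" "ball (\<phi> f) e \<subseteq> U"
    using Basis.prems unfolding open_contains_ball by auto
  then have "weak_nhd {\<phi>} e f \<subseteq> s"
    by (auto simp: weak_nhd_def s dist_norm norm_minus_commute subset_iff)
  then show ?case using s \<open>e > 0\<close> by (intro exI[of _ "{\<phi>}"] exI[of _ e]) auto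
qed simp

lemma openin_weak_nhd:
  assumes "finite \<Phi>" "\<And>\<phi>. \<phi> \<in> \<Phi> \<Longrightarrow> cfunctional \<phi>"
  shows "openin weak_topology (weak_nhd \<Phi> e f)"
proof -
  have "openin weak_topology ({g. cmod (\<phi> g - \<phi> f) < e})" if "\<phi> \<in> \<Phi>" for \<phi>
  proof -
    have "{g. cmod (\<phi> g - \<phi> f) < e} = \<phi> -` ball (\<phi> f) e"
      by (auto simp: dist_norm norm_minus_commute)
    then show ?thesis using openin_weak_vimage[OF assms(2)[OF that], of "ball (\<phi> f) e"] by simp
  qed
  moreover have "weak_nhd \<Phi> e f = UNIV \<inter> (\<Inter>\<phi>\<in>\<Phi>. {g. cmod (\<phi> g - \<phi> f) < e})"
    by (auto simp: weak_nhd_def)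
  moreover have "openin weak_topology (UNIV :: ('a \<Rightarrow>\<^sub>C complex) set)"
    using openin_topspace[of "weak_topology :: ('a \<Rightarrow>\<^sub>C complex) topology"] by simp
  ultimately show ?thesis
    using assms(1) by (cases "\<Phi> = {}") (auto intro!: openin_INT2)
qed

lemma openin_weak_imp_open: "openin weak_topology W \<Longrightarrow> open W"
  unfolding openin_weak_topology_iff
proof (induction rule: generate_topology_on.induct)
  case (Basis s)
  then obtain \<phi> U where "s = \<phi> -` U" "cfunctional \<phi>" "open U" by blast
  then show ?case
    by (simp add: cfunctional_def open_vimage linear_continuous_on)
qed auto

lemma compactin_weak_if_compact: "compact A \<Longrightarrow> compactin weak_topology A"
  unfolding compactin_def
proof (intro conjI allI impI)
  fix \<U> :: "('a \<Rightarrow>\<^sub>C complex) set set"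
  assume A: "compact A" and "Ball \<U> (openin weak_topology) \<and> A \<subseteq> \<Union>\<U>"
  then have "A \<subseteq> \<Union>\<U>" "\<And>B. B \<in> \<U> \<Longrightarrow> open B"
    using openin_weak_imp_open by auto
  with A obtain \<F> where "\<F> \<subseteq> \<U>" "finite \<F>" "A \<subseteq> \<Union>\<F>"
    by (rule compactE)
  then show "\<exists>\<F>. finite \<F> \<and> \<F> \<subseteq> \<U> \<and> A \<subseteq> \<Union>\<F>" by blast
qed simp

lemma cfunctional_apply: "cfunctional (\<lambda>f. apply_bcontfun f x)"
  unfolding cfunctional_def
proof (intro conjI allI bounded_linear_intro[where K = 1])
  show "norm (apply_bcontfun f x) \<le> norm f * 1" for f :: "'a \<Rightarrow>\<^sub>C complex"
    by (simp add: norm_bounded)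
qed (auto simp: cscale.rep_eq plus_bcontfun.rep_eq scaleR_bcontfun.rep_eq)

lemma Hausdorff_weak_topology: "Hausdorff_space weak_topology"
  unfolding Hausdorff_space_def
proof (intro allI impI)
  fix f g :: "'a \<Rightarrow>\<^sub>C complex"
  assume "f \<in> topspace weak_topology \<and> g \<in> topspace weak_topology \<and> f \<noteq> g"
  then obtain x where "apply_bcontfun f x \<noteq> apply_bcontfun g x"
    using bcontfun_eqI[of f g] by auto
  from hausdorff[OF this] obtain U V where UV: "open U" "open V" "apply_bcontfun f x \<in> U" "apply_bcontfun g x \<in> V" "U \<inter> V = {}"
    by auto
  let ?\<phi> = "\<lambda>f. apply_bcontfun f x"
  show "\<exists>U V. openin weak_topology U \<and> openin weak_topology V \<and> f \<in> U \<and> g \<in> V \<and> disjnt U V"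
    using UV openin_weak_vimage[OF cfunctional_apply]
    by (intro exI[of _ "?\<phi> -` U"] exI[of _ "?\<phi> -` V"]) (auto simp: disjnt_def)
qed

text \<open>Enlarging a weakly compact set \<open>A\<close> by a set \<open>B\<close> preserves weak compactness if \<open>B\<close> accumulates
  only at \<open>A\<close>: for every weak neighbourhood of zero, all of \<open>B\<close> outside a norm compact subset of
  \<open>B\<close> lies in the corresponding neighbourhood of \<open>A\<close>. Finitely many members of an open cover
  contain such a uniform neighbourhood of \<open>A\<close>, and finitely many more take care of the norm compact
  rest.\<close>

lemma weakly_compact_Un:
  fixes A B :: "('a::topological_space \<Rightarrow>\<^sub>C complex) set"
  assumes A: "compactin weak_topology A"
    and near: "\<And>\<Phi> e. finite \<Phi> \<Longrightarrow> (\<And>\<phi>. \<phi> \<in> \<Phi> \<Longrightarrow> cfunctional \<phi>) \<Longrightarrow> e > 0 \<Longrightarrow>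
       \<exists>C \<subseteq> B. compact C \<and> (\<forall>g \<in> B - C. \<exists>f\<in>A. g \<in> weak_nhd \<Phi> e f)"
  shows "compactin weak_topology (A \<union> B)"
  unfolding compactin_def
proof (intro conjI allI impI)
  fix \<U> :: "('a \<Rightarrow>\<^sub>C complex) set set"
  assume \<U>: "Ball \<U> (openin weak_topology) \<and> A \<union> B \<subseteq> \<Union>\<U>"
  have "\<exists>W \<Phi> e. W \<in> \<U> \<and> finite \<Phi> \<and> (\<forall>\<phi>\<in>\<Phi>. cfunctional \<phi>) \<and> e > 0 \<and> weak_nhd \<Phi> e f \<subseteq> W"
    if f: "f \<in> A" for f
  proof -
    obtain W where W: "W \<in> \<U>" "f \<in> W" using \<U> f by auto
    then show ?thesis using openin_weak_imp_nhd[of W f] \<U> by blast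
  qed
  then obtain W \<Phi> e where W: "\<And>f. f \<in> A \<Longrightarrow> W f \<in> \<U> \<and> finite (\<Phi> f) \<and> (\<forall>\<phi>\<in>\<Phi> f. cfunctional \<phi>)
      \<and> e f > (0::real) \<and> weak_nhd (\<Phi> f) (e f) f \<subseteq> W f"
    by metis
  have "Ball ((\<lambda>f. weak_nhd (\<Phi> f) (e f / 2) f) ` A) (openin weak_topology)"
    using W by (auto intro: openin_weak_nhd)
  moreover have "A \<subseteq> \<Union>((\<lambda>f. weak_nhd (\<Phi> f) (e f / 2) f) ` A)"
    using W by (auto simp: weak_nhd_def)
  ultimately obtain \<F> where "finite \<F>" "\<F> \<subseteq> (\<lambda>f. weak_nhd (\<Phi> f) (e f / 2) f) ` A" "A \<subseteq> \<Union>\<F>"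
    using A unfolding compactin_def by meson
  then obtain F where F: "finite F" "F \<subseteq> A" "A \<subseteq> (\<Union>f\<in>F. weak_nhd (\<Phi> f) (e f / 2) f)"
    using finite_subset_image[of \<F> "\<lambda>f. weak_nhd (\<Phi> f) (e f / 2) f" A] by auto
  \<comment> \<open>The halved radii leave room for a uniform neighbourhood of \<open>A\<close>, as with a Lebesgue
    number.\<close>
  define \<Psi> where "\<Psi> = (\<Union>f\<in>F. \<Phi> f)"
  define d where "d = Min (insert 1 ((\<lambda>f. e f / 2) ` F))"
  have d: "d > 0" "\<And>f. f \<in> F \<Longrightarrow> d \<le> e f / 2"
  proof -
    show "d > 0"
      unfolding d_def using F W by (subst Min_gr_iff) auto
    show "d \<le> e f / 2" if "f \<in> F" for f
      unfolding d_def using F(1) that by (intro Min_le) auto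
  qed
  obtain C where C: "C \<subseteq> B" "compact C" "\<And>g. g \<in> B - C \<Longrightarrow> \<exists>f\<in>A. g \<in> weak_nhd \<Psi> d f"
  proof -
    have "finite \<Psi>" "\<And>\<phi>. \<phi> \<in> \<Psi> \<Longrightarrow> cfunctional \<phi>"
      using F W unfolding \<Psi>_def by auto
    from near[OF this d(1)] show thesis using that by auto
  qed
  have "compactin weak_topology C"
    by (rule compactin_weak_if_compact[OF C(2)])
  then obtain \<V> where \<V>: "finite \<V>" "\<V> \<subseteq> \<U>" "C \<subseteq> \<Union>\<V>"
  proof -
    have "Ball \<U> (openin weak_topology)" "C \<subseteq> \<Union>\<U>"
      using \<U> C(1) by blast+
    with \<open>compactin weak_topology C\<close> show thesis
      using that unfolding compactin_def by meson
  qed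
  have close: "g \<in> \<Union>(W ` F)" if f: "f \<in> A" and g: "g \<in> weak_nhd \<Psi> d f" for f g
  proof -
    obtain f' where f': "f' \<in> F" "f \<in> weak_nhd (\<Phi> f') (e f' / 2) f'"
      using F(3) f by blast
    have "g \<in> weak_nhd (\<Phi> f') (e f') f'"
      unfolding weak_nhd_def
    proof (intro CollectI ballI)
      fix \<phi> assume \<phi>: "\<phi> \<in> \<Phi> f'"
      have "cmod (\<phi> g - \<phi> f) < e f' / 2"
        using g \<phi> f'(1) d(2)[OF f'(1)] unfolding weak_nhd_def \<Psi>_def by fastforce
      moreover have "cmod (\<phi> f - \<phi> f') < e f' / 2"
        using f'(2) \<phi> unfolding weak_nhd_def by blast
      ultimately show "cmod (\<phi> g - \<phi> f') < e f'"
        using norm_triangle_lt[of "\<phi> g - \<phi> f" "\<phi> f - \<phi> f'" "e f'"] by simp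
    qed
    then show ?thesis using W[of f'] F(2) f'(1) by blast
  qed
  have "f \<in> weak_nhd \<Psi> d f" for f
    using d(1) by (simp add: weak_nhd_def)
  then have "A \<subseteq> \<Union>(W ` F)"
    using close by blast
  moreover have "B \<subseteq> \<Union>(W ` F) \<union> \<Union>\<V>"
    using C(3) \<V>(3) close by blast
  ultimately show "\<exists>\<F>. finite \<F> \<and> \<F> \<subseteq> \<U> \<and> A \<union> B \<subseteq> \<Union>\<F>"
    using W F \<V> by (intro exI[of _ "W ` F \<union> \<V>"]) (auto simp: subset_iff)
qed simp

lemma relatively_weakly_compact_subset:
  assumes "A \<subseteq> X" "compactin weak_topology X"
  shows "relatively_weakly_compact A"
proof -
  have "closedin weak_topology X"
    using assms(2) Hausdorff_weak_topology compactin_imp_closedin by blast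
  then have "weak_topology closure_of A \<subseteq> X"
    using assms(1) closure_of_minimal by blast
  then show ?thesis
    unfolding relatively_weakly_compact_def
    using closed_compactin[OF assms(2)] closedin_closure_of by blast
qed

text \<open>Functions with disjoint supports span a copy of a space with maximum norm, on which the
  functional acts as a summable sequence: multiply each function by the phase that makes its value
  under \<open>\<phi>\<close> nonnegative and evaluate \<open>\<phi>\<close> at the sum, whose norm is still at most \<open>M\<close>.\<close>

lemma cfunctional_disjoint_sum:
  fixes g :: "nat \<Rightarrow> ('a::topological_space \<Rightarrow>\<^sub>C complex)"
  assumes \<phi>: "cfunctional \<phi>"
    and disj: "\<And>j k x. j < k \<Longrightarrow> k < N \<Longrightarrow> g j x = 0 \<or> g k x = 0"
    and bound: "\<And>k x. k < N \<Longrightarrow> cmod (g k x) \<le> M" and M: "M \<ge> 0"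
  shows "(\<Sum>k<N. cmod (\<phi> (g k))) \<le> onorm \<phi> * M"
proof -
  interpret bounded_linear \<phi> using \<phi> by (simp add: cfunctional_def)
  define s where "s k = cnj (sgn (\<phi> (g k)))" for k
  have s: "s k * \<phi> (g k) = of_real (cmod (\<phi> (g k)))" for k
    by (cases "\<phi> (g k) = 0")
      (simp_all add: s_def sgn_eq complex_norm_square[symmetric] field_simps power2_eq_square flip: of_real_mult)
  have s1: "cmod (s k) \<le> 1" for k
    by (simp add: s_def norm_sgn)
  define h where "h = (\<Sum>k<N. cscale (s k) (g k))"
  have h_apply: "h x = (\<Sum>k<N. s k * g k x)" for x
    unfolding h_def by (induction N) (simp_all add: zero_bcontfun.rep_eq plus_bcontfun.rep_eq cscale.rep_eq)
  have "norm h \<le> M"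
  proof (rule norm_bound)
    fix x
    show "norm (apply_bcontfun h x) \<le> M"
    proof (cases "\<exists>k<N. g k x \<noteq> 0")
      case True
      then obtain k where k: "k < N" "g k x \<noteq> 0" by blast
      have "h x = (\<Sum>j\<in>{k}. s j * g j x)"
        unfolding h_apply
      proof (rule sum.mono_neutral_right)
        show "\<forall>j\<in>{..<N} - {k}. s j * g j x = 0"
        proof
          fix j assume "j \<in> {..<N} - {k}"
          then have "j < k \<or> k < j" "j < N" by auto
          then show "s j * g j x = 0"
            using disj[of j k x] disj[of k j x] k by auto
        qed
      qed (use k in auto)
      then show ?thesis
        using mult_mono[OF s1[of k] bound[OF k(1), of x]] by (simp add: norm_mult)
    next
      case False
      then show ?thesis using M by (simp add: h_apply)
    qed
  qed
  have "(\<Sum>k<N. cmod (\<phi> (g k))) = cmod (of_real (\<Sum>k<N. cmod (\<phi> (g k))))"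
    by (subst norm_of_real) (simp add: sum_nonneg)
  also have "of_real (\<Sum>k<N. cmod (\<phi> (g k))) = \<phi> h"
    using \<phi> by (simp add: h_def sum cfunctional_def s)
  also have "cmod (\<phi> h) \<le> onorm \<phi> * norm h"
    by (rule onorm[OF bounded_linear_axioms])
  also have "\<dots> \<le> onorm \<phi> * M"
    using \<open>norm h \<le> M\<close> by (simp add: mult_left_mono onorm_pos_le[OF bounded_linear_axioms])
  finally show ?thesis .
qed

text \<open>Hence a bounded sequence with disjoint supports is weakly null, and the same holds for the
  sum of two such sequences.\<close>

lemma disjoint_families_small:
  fixes d r :: "nat \<Rightarrow> ('a::topological_space \<Rightarrow>\<^sub>C complex)"
  assumes \<Phi>: "finite \<Phi>" "\<And>\<phi>. \<phi> \<in> \<Phi> \<Longrightarrow> cfunctional \<phi>" and e: "e > 0"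
    and d: "\<And>j k x. j < k \<Longrightarrow> d j x = 0 \<or> d k x = 0" "\<And>k x. cmod (d k x) \<le> M"
    and r: "\<And>j k x. j < k \<Longrightarrow> r j x = 0 \<or> r k x = 0" "\<And>k x. cmod (r k x) \<le> M"
  shows "\<exists>k. \<forall>\<phi>\<in>\<Phi>. cmod (\<phi> (d k)) + cmod (\<phi> (r k)) < e"
proof (rule ccontr)
  assume "\<not> ?thesis"
  then have large: "\<exists>\<phi>\<in>\<Phi>. e \<le> cmod (\<phi> (d k)) + cmod (\<phi> (r k))" for k
    by (auto simp: not_less)
  have M: "M \<ge> 0"
    using d(2)[of 0 undefined] norm_ge_zero order_trans by blast
  let ?B = "\<Sum>\<phi>\<in>\<Phi>. 2 * (onorm \<phi> * M)"
  have "real N * e \<le> ?B" for N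
  proof -
    have "real N * e = (\<Sum>k<N. e)" by simp
    also have "\<dots> \<le> (\<Sum>k<N. \<Sum>\<phi>\<in>\<Phi>. cmod (\<phi> (d k)) + cmod (\<phi> (r k)))"
    proof (rule sum_mono)
      fix k
      obtain \<phi> where \<phi>: "\<phi> \<in> \<Phi>" "e \<le> cmod (\<phi> (d k)) + cmod (\<phi> (r k))"
        using large by blast
      note \<phi>(2)
      also have "cmod (\<phi> (d k)) + cmod (\<phi> (r k)) \<le> (\<Sum>\<phi>\<in>\<Phi>. cmod (\<phi> (d k)) + cmod (\<phi> (r k)))"
        using \<phi>(1) \<Phi>(1) by (intro member_le_sum) auto
      finally show "e \<le> (\<Sum>\<phi>\<in>\<Phi>. cmod (\<phi> (d k)) + cmod (\<phi> (r k)))" .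
    qed
    also have "\<dots> = (\<Sum>\<phi>\<in>\<Phi>. (\<Sum>k<N. cmod (\<phi> (d k))) + (\<Sum>k<N. cmod (\<phi> (r k))))"
      by (subst sum.swap) (simp add: sum.distrib)
    also have "\<dots> \<le> (\<Sum>\<phi>\<in>\<Phi>. onorm \<phi> * M + onorm \<phi> * M)"
      using \<Phi>(2) d r M by (intro sum_mono add_mono cfunctional_disjoint_sum) auto
    also have "\<dots> = ?B" by (simp only: mult_2)
    finally show ?thesis .
  qed
  moreover obtain N where "?B < real N * e"
    using reals_Archimedean3[OF e] by blast
  ultimately show False by (meson not_less)
qed


section \<open>Translates of a bump\<close>

definition left_unif_cont :: "('g::{topological_group_add, t2_space} \<Rightarrow> complex) \<Rightarrow> bool" where
  "left_unif_cont f \<longleftrightarrow> (\<forall>e>0. \<exists>V. open V \<and> 0 \<in> V \<and> (\<forall>v\<in>V. \<forall>y. cmod (f (v + y) - f y) < e))"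

lemma open_right_shift:
  fixes V :: "'g::topological_group_add set"
  assumes "open V"
  shows "open {x. x - y \<in> V}"
proof -
  have "open ((\<lambda>x. x - y) -` V)"
    using assms by (intro open_vimage) (auto intro!: continuous_intros)
  then show ?thesis by (simp add: vimage_def)
qed

text \<open>The points \<open>v + y\<close> with \<open>v\<close> near \<open>0\<close> form a neighbourhood of \<open>y\<close>, so a uniform estimate
  along left shifts gives continuity at \<open>y\<close>.\<close>

lemma left_unif_cont_imp_continuous:
  assumes "left_unif_cont f"
  shows "continuous_on UNIV f"
proof (intro continuous_at_imp_continuous_on ballI)
  fix y
  show "isCont f y"
    unfolding isCont_def tendsto_iff eventually_at_topological
  proof (intro allI impI)
    fix e :: real assume "e > 0"
    then obtain V where V: "open V" "0 \<in> V" "\<And>v y. v \<in> V \<Longrightarrow> cmod (f (v + y) - f y) < e"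
      using assms unfolding left_unif_cont_def by meson
    have "dist (f x) (f y) < e" if "x - y \<in> V" for x
      using V(3)[OF that, of y] by (simp add: dist_norm)
    then show "\<exists>S. open S \<and> y \<in> S \<and> (\<forall>x\<in>S. x \<noteq> y \<longrightarrow> x \<in> UNIV \<longrightarrow> dist (f x) (f y) < e)"
      using V(1,2) open_right_shift[OF V(1), of y] by (intro exI[of _ "{x. x - y \<in> V}"]) auto
  qed
qed

text \<open>For the orbit map the same estimate is read at \<open>y + u\<close> for all \<open>u\<close> simultaneously; this is what
  makes compact pieces of an orbit norm compact.\<close>

lemma left_unif_cont_translate_continuous:
  fixes f :: "'g::{topological_group_add, t2_space} \<Rightarrow>\<^sub>C complex"
  assumes "left_unif_cont (apply_bcontfun f)"
  shows "continuous_on UNIV (\<lambda>s. left_translate s f)"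
proof (intro continuous_at_imp_continuous_on ballI)
  fix y
  show "isCont (\<lambda>s. left_translate s f) y"
    unfolding isCont_def tendsto_iff eventually_at_topological
  proof (intro allI impI)
    fix e :: real assume "e > 0"
    then obtain V where V: "open V" "0 \<in> V" "\<And>v y. v \<in> V \<Longrightarrow> cmod (f (v + y) - f y) < e / 2"
      using assms half_gt_zero unfolding left_unif_cont_def by meson
    have "dist (left_translate x f) (left_translate y f) < e" if "x - y \<in> V" for x
    proof -
      have "dist (left_translate x f) (left_translate y f) \<le> e / 2"
      proof (rule dist_bound)
        fix u
        have "(x - y) + (y + u) = x + u" by (metis add.assoc diff_add_cancel)
        then show "dist (left_translate x f u) (left_translate y f u) \<le> e / 2"
          using V(3)[OF that, of "y + u"] by (simp add: dist_norm left_translate.rep_eq)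
      qed
      then show ?thesis using \<open>e > 0\<close> by simp
    qed
    then show "\<exists>S. open S \<and> y \<in> S \<and> (\<forall>x\<in>S. x \<noteq> y \<longrightarrow> x \<in> UNIV \<longrightarrow>
        dist (left_translate x f) (left_translate y f) < e)"
      using V(1,2) open_right_shift[OF V(1), of y] by (intro exI[of _ "{x. x - y \<in> V}"]) auto
  qed
qed

lemma compact_image2:
  fixes f :: "'a::topological_space \<Rightarrow> 'b::topological_space \<Rightarrow> 'c::topological_space"
  assumes "compact A" "compact B" "continuous_on UNIV (\<lambda>(x, y). f x y)"
  shows "compact {f x y | x y. x \<in> A \<and> y \<in> B}"
proof -
  have "{f x y | x y. x \<in> A \<and> y \<in> B} = (\<lambda>(x, y). f x y) ` (A \<times> B)" by auto
  then show ?thesis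
    using compact_continuous_image[OF continuous_on_subset[OF assms(3)] compact_Times[OF assms(1,2)]] by simp
qed

text \<open>A set that no compact set contains admits sequences whose \<open>k\<close>th member avoids any compact
  set prescribed by the earlier members. The requirement on the earlier members \<open>A\<close> is expressed by
  a relation \<open>R A r\<close> in addition to a symmetric relation \<open>D\<close> between any two members, so that the
  compact set only has to exist once the earlier members are related by \<open>D\<close>.\<close>

lemma escaping_sequence:
  fixes S :: "'g::topological_space set"
  assumes S: "\<And>K. compact K \<Longrightarrow> \<not> S \<subseteq> K" and D: "\<And>a b. D a b \<Longrightarrow> D b a"
    and step: "\<And>A. finite A \<Longrightarrow> pairwise D A \<Longrightarrow> \<exists>K. compact K \<and> (\<forall>r. r \<notin> K \<longrightarrow> (\<forall>a\<in>A. D a r) \<and> R A r)"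
  shows "\<exists>s :: nat \<Rightarrow> 'g. \<forall>k. s k \<in> S \<and> (\<forall>j<k. D (s j) (s k)) \<and> R (s ` {..<k}) (s k)"
proof -
  let ?P = "\<lambda>s (k :: nat) r. r \<in> S \<and> (\<forall>j<k. D (s j) r) \<and> R (s ` {..<k}) r"
  have "wf {(j, k :: nat). j < k}" by (rule wf_less)
  moreover have "?P f k r = ?P g k r" if eq: "\<And>j. (j, k) \<in> {(j, k). j < k} \<Longrightarrow> f j = g j"
    for f g :: "nat \<Rightarrow> 'g" and k r
  proof -
    have "f ` {..<k} = g ` {..<k}"
      using eq by (intro image_cong) auto
    then show ?thesis using eq by simp
  qed
  moreover have "\<exists>r. ?P s k r" if IH: "\<And>j. (j, k) \<in> {(j, k). j < k} \<Longrightarrow> ?P s j (s j)"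
    for s :: "nat \<Rightarrow> 'g" and k
  proof -
    have "D (s i) (s j)" if "i < k" "j < k" "i \<noteq> j" for i j
      using that IH[of i] IH[of j] D by (cases "i < j") auto
    then have "pairwise D (s ` {..<k})"
      by (auto simp: pairwise_def)
    then obtain K where K: "compact K" "\<And>r. r \<notin> K \<Longrightarrow> (\<forall>a\<in>s ` {..<k}. D a r) \<and> R (s ` {..<k}) r"
      using step[of "s ` {..<k}"] by auto
    obtain r where "r \<in> S" "r \<notin> K" using S[OF K(1)] by blast
    then show ?thesis using K(2)[of r] by auto
  qed
  ultimately have "\<exists>s. \<forall>k. ?P s k (s k)" by (rule dependent_wf_choice[where P = ?P])
  then show ?thesis .
qed

locale bump =
  fixes U :: "'g::{topological_group_add, t2_space} set" and h :: "'g \<Rightarrow> complex"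
  assumes U_compact: "compact U" and U_nhd: "0 \<in> interior U" and U_uminus: "x \<in> U \<Longrightarrow> - x \<in> U"
    and h_continuous: "continuous_on UNIV h" and h_support: "h x \<noteq> 0 \<Longrightarrow> x \<in> U"
    and h_le: "cmod (h x) \<le> 1" and h_0: "h 0 = 1"
begin

lemma U_0: "0 \<in> U"
  using U_nhd interior_subset by blast

definition UU :: "'g set" where
  "UU = {x + y | x y. x \<in> U \<and> y \<in> U}"

lemma UU_compact: "compact UU"
  unfolding UU_def by (intro compact_image2 U_compact) (auto simp: case_prod_unfold intro!: continuous_intros)

lemma UU_I: "x \<in> U \<Longrightarrow> y \<in> U \<Longrightarrow> x + y \<in> UU"
  unfolding UU_def by blast

lemma UU_sub: "x \<in> U \<Longrightarrow> x \<in> UU"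
  using UU_I[OF U_0, of x] by simp

lemma UU_uminus:
  assumes "x \<in> UU"
  shows "- x \<in> UU"
proof -
  obtain a b where "x = a + b" "a \<in> U" "b \<in> U"
    using assms unfolding UU_def by blast
  then show ?thesis
    using UU_I[OF U_uminus U_uminus, of b a] by (simp add: minus_add)
qed

text \<open>The modulus \<open>h (v + y) - h y\<close> vanishes for \<open>v = 0\<close>, so by the tube lemma it is small near
  \<open>v = 0\<close> for all \<open>y\<close> in the compact set \<open>U + U\<close>; for \<open>v\<close> in \<open>U\<close> and \<open>y\<close> outside \<open>U + U\<close> both
  terms are zero.\<close>

lemma h_left_unif_cont: "left_unif_cont h"
  unfolding left_unif_cont_def
proof (intro allI impI)
  fix e :: real assume "e > 0"
  let ?d = "\<lambda>p :: 'g \<times> 'g. cmod (h (fst p + snd p) - h (snd p))"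
  have "continuous_on UNIV ?d"
    by (intro continuous_intros continuous_on_compose2[OF h_continuous]) auto
  then have "open (?d -` {..<e})"
    by (rule open_vimage[rotated]) simp
  moreover have "{0} \<times> UU \<subseteq> ?d -` {..<e}"
    using \<open>e > 0\<close> by auto
  ultimately obtain X where X: "0 \<in> X" "open X" "X \<times> UU \<subseteq> ?d -` {..<e}"
    using Elementary_Topology.tube_lemma[OF UU_compact, of "?d -` {..<e}" "0 :: 'g"] by auto
  have "cmod (h (v + y) - h y) < e" if v: "v \<in> X \<inter> interior U" for v y
  proof (cases "y \<in> UU")
    case True
    then show ?thesis using X(3) v by auto
  next
    case False
    have "h y = 0"
      using False UU_I[of 0 y] U_0 h_support by fastforce
    moreover have "h (v + y) = 0"
    proof (rule ccontr)
      assume hv: "h (v + y) \<noteq> 0"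
      have "v \<in> U" using v interior_subset by blast
      then have "- v + (v + y) \<in> UU"
        by (intro UU_I U_uminus h_support[OF hv])
      then show False using False by simp
    qed
    ultimately show ?thesis using \<open>e > 0\<close> by simp
  qed
  then show "\<exists>V. open V \<and> 0 \<in> V \<and> (\<forall>v\<in>V. \<forall>y. cmod (h (v + y) - h y) < e)"
    using X(1,2) U_nhd by (intro exI[of _ "X \<inter> interior U"]) auto
qed

definition bcont_h :: "'g \<Rightarrow>\<^sub>C complex" where
  "bcont_h = Bcontfun h"

lemma apply_bcont_h [simp]: "apply_bcontfun bcont_h = h"
  unfolding bcont_h_def by (rule Bcontfun_inverse) (auto intro: bcontfun_normI h_continuous h_le)

definition bump_translates :: "real \<Rightarrow> ('g \<Rightarrow>\<^sub>C complex) set" where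
  "bump_translates M = {cscale z (left_translate s bcont_h) | z s. cmod z \<le> M}"

text \<open>This says that \<open>U\<close> shifted by \<open>- a\<close> and \<open>U\<close> shifted by \<open>- b\<close>, both from the left, are disjoint.\<close>

definition far :: "'g \<Rightarrow> 'g \<Rightarrow> bool" where
  "far a b \<longleftrightarrow> a - b \<notin> UU"

lemma far_sym: "far a b \<Longrightarrow> far b a"
  unfolding far_def using UU_uminus[of "b - a"] by auto

lemma far_neq: "far a b \<Longrightarrow> a \<noteq> b"
  unfolding far_def using UU_I[OF U_0 U_0] by auto

lemma compact_not_far:
  assumes "finite A"
  shows "\<exists>K. compact K \<and> (\<forall>r. r \<notin> K \<longrightarrow> (\<forall>a\<in>A. far a r))"
proof -
  let ?K = "\<Union>a\<in>A. (\<lambda>x. x + a) ` UU"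
  have 1: "compact ?K"
    by (intro compact_UN[OF assms] compact_continuous_image[OF _ UU_compact] continuous_intros)
  have 2: "far a r" if "r \<notin> ?K" "a \<in> A" for a r
  proof (rule far_sym)
    have "r - a \<notin> UU"
    proof
      assume "r - a \<in> UU"
      then have "r \<in> (\<lambda>x. x + a) ` UU"
        by (intro image_eqI[of _ _ "r - a"]) simp_all
      then show False using that by auto
    qed
    then show "far r a" by (simp add: far_def)
  qed
  show ?thesis
    by (intro exI[of _ ?K] conjI allI impI ballI 1 2)
qed

lemma continuous_bump_translate:
  "continuous_on UNIV (\<lambda>(z, s). cscale z (left_translate s bcont_h))"
proof -
  have lt: "continuous_on UNIV (\<lambda>s. left_translate s bcont_h)"
    by (rule left_unif_cont_translate_continuous) (simp add: h_left_unif_cont)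
  have add: "cscale (z + w) f = cscale z f + cscale w f" for z w and f :: "'g \<Rightarrow>\<^sub>C complex"
    by (rule bcf.scale_left_distrib)
  have add': "cscale z (f + g) = cscale z f + cscale z g" for z and f g :: "'g \<Rightarrow>\<^sub>C complex"
    by (rule bcf.scale_right_distrib)
  have "bounded_bilinear (cscale :: complex \<Rightarrow> ('g \<Rightarrow>\<^sub>C complex) \<Rightarrow> _)"
  proof (unfold_locales, goal_cases)
    case 1 show ?case by (rule add)
  next
    case 2 show ?case by (rule add')
  next
    case 3 show ?case by (intro bcontfun_eqI) (simp add: cscale.rep_eq scaleR_bcontfun.rep_eq)
  next
    case 4 show ?case by (intro bcontfun_eqI) (simp add: cscale.rep_eq scaleR_bcontfun.rep_eq)
  next
    case 5 show ?case by (intro exI[of _ 1]) (simp add: norm_cscale_le)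
  qed
  moreover have "continuous_on UNIV (fst :: complex \<times> 'g \<Rightarrow> complex)"
    by (intro continuous_intros)
  moreover have "continuous_on UNIV (\<lambda>p :: complex \<times> 'g. left_translate (snd p) bcont_h)"
    by (rule continuous_on_compose2[OF lt continuous_on_snd[OF continuous_on_id]]) simp
  ultimately show ?thesis
    unfolding case_prod_unfold by (rule bounded_bilinear.continuous_on)
qed

text \<open>The scaled translates of the bump accumulate weakly only at zero: translates by elements
  that run away from all compact sets have disjoint supports along a subsequence.\<close>

lemma bump_translates_weakly_compact:
  assumes "M \<ge> 0"
  shows "compactin weak_topology (bump_translates M)"
proof -
  have "compactin weak_topology ({0} \<union> bump_translates M)"
  proof (rule weakly_compact_Un)
    show "compactin weak_topology {0 :: 'g \<Rightarrow>\<^sub>C complex}"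
      by (rule compactin_weak_if_compact) simp
  next
    fix \<Phi> :: "(('g \<Rightarrow>\<^sub>C complex) \<Rightarrow> complex) set" and e :: real
    assume \<Phi>: "finite \<Phi>" "\<And>\<phi>. \<phi> \<in> \<Phi> \<Longrightarrow> cfunctional \<phi>" and e: "e > 0"
    define S where "S = {s. \<exists>z. cmod z \<le> M \<and> cscale z (left_translate s bcont_h) \<notin> weak_nhd \<Phi> e 0}"
    have "\<exists>K. compact K \<and> S \<subseteq> K"
    proof (rule ccontr)
      assume S: "\<not> ?thesis"
      have "\<exists>s :: nat \<Rightarrow> 'g. \<forall>k. s k \<in> S \<and> (\<forall>j<k. far (s j) (s k)) \<and> True"
      proof (rule escaping_sequence)
        show "\<not> S \<subseteq> K" if "compact K" for K
          using S that by blast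
        show "far b a" if "far a b" for a b
          using that by (rule far_sym)
        show "\<exists>K. compact K \<and> (\<forall>r. r \<notin> K \<longrightarrow> (\<forall>a\<in>A. far a r) \<and> True)" if "finite A" for A
          using compact_not_far[OF that] by simp
      qed
      then obtain s :: "nat \<Rightarrow> 'g" where s: "\<And>k. s k \<in> S" "\<And>j k. j < k \<Longrightarrow> far (s j) (s k)"
        by auto
      then obtain z where z: "\<And>k. cmod (z k) \<le> M"
          "\<And>k. cscale (z k) (left_translate (s k) bcont_h) \<notin> weak_nhd \<Phi> e 0"
        unfolding S_def by (simp only: mem_Collect_eq) metis
      define d where "d k = cscale (z k) (left_translate (s k) bcont_h)" for k
      have d_apply: "d k x = z k * h (s k + x)" for k x
        by (simp add: d_def cscale.rep_eq left_translate.rep_eq)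
      have "d j x = 0 \<or> d k x = 0" if "j < k" for j k x
      proof (rule ccontr)
        assume "\<not> ?thesis"
        then have "s j + x \<in> U" "s k + x \<in> U"
          using h_support by (auto simp: d_apply)
        then have "(s j + x) + - (s k + x) \<in> UU"
          by (intro UU_I U_uminus)
        moreover have "(s j + x) + - (s k + x) = s j - s k"
          by (simp add: diff_conv_add_uminus add.assoc minus_add del: add_uminus_conv_diff)
        ultimately show False using s(2)[OF that] by (simp add: far_def)
      qed
      moreover have "cmod (d k x) \<le> M" for k x
        using mult_mono[OF z(1)[of k] h_le[of "s k + x"]] assms by (simp add: d_apply norm_mult)
      ultimately obtain k where "\<forall>\<phi>\<in>\<Phi>. cmod (\<phi> (d k)) + cmod (\<phi> (0 :: 'g \<Rightarrow>\<^sub>C complex)) < e"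
        using disjoint_families_small[OF \<Phi> e, of d M "\<lambda>_. 0"] assms
        by (auto simp: zero_bcontfun.rep_eq)
      moreover have "\<phi> 0 = 0" if "\<phi> \<in> \<Phi>" for \<phi>
        using \<Phi>(2)[OF that] linear_simps(3) unfolding cfunctional_def by blast
      ultimately have "d k \<in> weak_nhd \<Phi> e 0"
        unfolding weak_nhd_def by fastforce
      then show False using z(2)[of k] by (simp add: d_def)
    qed
    then obtain K where K: "compact K" "S \<subseteq> K" by blast
    let ?C = "(\<lambda>(z, s). cscale z (left_translate s bcont_h)) ` (cball 0 M \<times> K)"
    have "compact ?C"
      by (intro compact_continuous_image compact_Times K(1) continuous_on_subset[OF continuous_bump_translate]) auto
    moreover have "?C \<subseteq> bump_translates M"
      unfolding bump_translates_def by auto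
    moreover have "\<forall>g \<in> bump_translates M - ?C. \<exists>f\<in>{0}. g \<in> weak_nhd \<Phi> e f"
    proof
      fix g assume g: "g \<in> bump_translates M - ?C"
      then obtain z s where zs: "g = cscale z (left_translate s bcont_h)" "cmod z \<le> M"
        unfolding bump_translates_def by blast
      have "s \<notin> K"
      proof
        assume "s \<in> K"
        then have "g \<in> ?C" using zs by (intro image_eqI[of _ _ "(z, s)"]) auto
        then show False using g by blast
      qed
      then show "\<exists>f\<in>{0}. g \<in> weak_nhd \<Phi> e f"
        using zs K(2) unfolding S_def by blast
    qed
    ultimately show "\<exists>C \<subseteq> bump_translates M. compact C \<and>
        (\<forall>g \<in> bump_translates M - C. \<exists>f\<in>{0}. g \<in> weak_nhd \<Phi> e f)"
      by blast
  qed
  moreover have "{0} \<union> bump_translates M = bump_translates M"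
  proof -
    have "cscale 0 (left_translate 0 bcont_h) \<in> bump_translates M"
      unfolding bump_translates_def using assms by force
    then show ?thesis by (simp add: insert_absorb)
  qed
  ultimately show ?thesis by simp
qed

end


section \<open>Sums of separated bumps\<close>

lemmas group_word_simps = add.assoc diff_conv_add_uminus minus_add minus_minus
  add_minus_cancel minus_add_cancel right_minus left_minus add_0_left add_0_right

text \<open>The points \<open>t l\<close> are spread out in the centre in two ways. The
  neighbourhood \<open>U + U + U + U\<close> of zero contains no difference of two distinct points, so the
  translated bumps are disjoint, with room to spare. And the difference lies in a given compact set
  for only finitely many pairs of distinct points. By centrality these differences can be computed
  at any position \<open>x\<close> in the group.\<close>

locale separated_bumps = bump U h for U :: "'g::{topological_group_add, t2_space} set" and h +
  fixes t :: "'l \<Rightarrow> 'g" and L :: "'l set"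
  assumes central: "l \<in> L \<Longrightarrow> t l + x = x + t l"
    and separated: "l \<in> L \<Longrightarrow> l' \<in> L \<Longrightarrow> l \<noteq> l' \<Longrightarrow> p \<in> UU \<Longrightarrow> q \<in> UU \<Longrightarrow> t l - t l' \<noteq> p + q"
    and locally_finite:
      "compact C \<Longrightarrow> finite {(l, l'). l \<in> L \<and> l' \<in> L \<and> l \<noteq> l' \<and> t l - t l' \<in> C}"
begin

lemma uminus_central:
  assumes "l \<in> L"
  shows "- t l + x = x - t l"
proof -
  have "- t l + x = - t l + (x + t l) - t l"
    by (simp only: group_word_simps)
  also have "\<dots> = x - t l"
    unfolding central[OF assms, symmetric] by (simp only: group_word_simps)
  finally show ?thesis .
qed

text \<open>The difference of two points can be read off from the positions of any \<open>x\<close> relative to both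
  of them.\<close>

lemma difference:
  assumes "l \<in> L" "l' \<in> L"
  shows "t l - t l' = - (- t l + x) + (- t l' + x)"
proof -
  have "- (- t l + x) + (- t l' + x) = - x + (t l + x) - t l'"
    unfolding uminus_central[OF assms(2)] by (simp only: group_word_simps)
  also have "\<dots> = t l - t l'"
    unfolding central[OF assms(1)] by (simp only: group_word_simps)
  finally show ?thesis by simp
qed

text \<open>A point and its shift by an element of \<open>U\<close> together see at most one bump. This is where the
  separation by four summands from \<open>U\<close> is used.\<close>

lemma near_unique:
  assumes l: "l \<in> L" "l' \<in> L" and v: "v \<in> U"
    and near: "- t l + y \<in> U \<or> - t l + (v + y) \<in> U" "- t l' + y \<in> U \<or> - t l' + (v + y) \<in> U"
  shows "l = l'"
proof (rule ccontr)
  assume "l \<noteq> l'"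
  have UU: "- t m + y \<in> UU" if m: "m \<in> L" and near: "- t m + y \<in> U \<or> - t m + (v + y) \<in> U" for m
    using near
  proof
    assume "- t m + (v + y) \<in> U"
    then have "- v + (- t m + (v + y)) \<in> UU"
      by (intro UU_I U_uminus v)
    also have "- v + (- t m + (v + y)) = - t m + y"
      unfolding uminus_central[OF m] by (simp only: group_word_simps)
    finally show ?thesis .
  qed (rule UU_sub)
  show False
    using separated[OF l \<open>l \<noteq> l'\<close> UU_uminus[OF UU[OF l(1) near(1)]] UU[OF l(2) near(2)]]
      difference[OF l] by blast
qed

lemma bump_unique:
  "l \<in> L \<Longrightarrow> l' \<in> L \<Longrightarrow> - t l + x \<in> U \<Longrightarrow> - t l' + x \<in> U \<Longrightarrow> l = l'"
  using near_unique[OF _ _ U_0] by blast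

definition bump_sum :: "('l \<Rightarrow> complex) \<Rightarrow> 'g \<Rightarrow> complex" where
  "bump_sum c x = (\<Sum>l | l \<in> L \<and> h (- t l + x) \<noteq> 0. c l * h (- t l + x))"

lemma bump_sum_single:
  assumes "l \<in> L" and "\<And>l'. l' \<in> L \<Longrightarrow> - t l' + x \<in> U \<Longrightarrow> l' = l"
  shows "bump_sum c x = c l * h (- t l + x)"
proof -
  have "m = l" if "m \<in> L" "h (- t m + x) \<noteq> 0" for m
    using assms(2)[OF that(1) h_support[OF that(2)]] .
  then have "(m \<in> L \<and> h (- t m + x) \<noteq> 0) = (m = l \<and> h (- t l + x) \<noteq> 0)" for m
    using assms(1) by blast
  then have "bump_sum c x = (\<Sum>m | m = l \<and> h (- t l + x) \<noteq> 0. c m * h (- t m + x))"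
    unfolding bump_sum_def by simp
  then show ?thesis
    by (cases "h (- t l + x) = 0") simp_all
qed

lemma bump_sum_at:
  assumes "l \<in> L" "- t l + x \<in> U"
  shows "bump_sum c x = c l * h (- t l + x)"
  using assms(1)
proof (rule bump_sum_single)
  show "l' = l" if "l' \<in> L" "- t l' + x \<in> U" for l'
    using bump_unique[OF that(1) assms(1) that(2) assms(2)] .
qed

lemma bump_sum_center: "l \<in> L \<Longrightarrow> bump_sum c (t l) = c l"
  using bump_sum_at[of l "t l"] U_0 by (simp add: h_0)

lemma bump_sum_outside:
  assumes "\<And>l. l \<in> L \<Longrightarrow> - t l + x \<notin> U"
  shows "bump_sum c x = 0"
proof -
  have "h (- t l + x) = 0" if "l \<in> L" for l
    using assms[OF that] h_support[of "- t l + x"] by auto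
  then have "{l. l \<in> L \<and> h (- t l + x) \<noteq> 0} = {}" by simp
  then show ?thesis
    unfolding bump_sum_def by (simp only: sum.empty)
qed

lemma bump_sum_nonzero:
  assumes "bump_sum c x \<noteq> 0"
  obtains l where "l \<in> L" "- t l + x \<in> U" "c l \<noteq> 0"
proof -
  obtain l where "l \<in> L" "- t l + x \<in> U"
    using assms bump_sum_outside[of x c] by auto
  then show thesis
    using assms that[of l] bump_sum_at[of l x c] by auto
qed

lemma norm_bump_sum_le:
  assumes "\<And>l. cmod (c l) \<le> M"
  shows "cmod (bump_sum c x) \<le> M"
proof -
  have M: "M \<ge> 0"
    using assms norm_ge_zero order_trans by blast
  show ?thesis
  proof (cases "\<exists>l\<in>L. - t l + x \<in> U")
    case True
    then obtain l where l: "l \<in> L" "- t l + x \<in> U" by blast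
    show ?thesis
      unfolding bump_sum_at[OF l] norm_mult
      using mult_mono[OF assms[of l] h_le[of "- t l + x"] M] by simp
  next
    case False
    then show ?thesis using bump_sum_outside[of x c] M by simp
  qed
qed

text \<open>By the preceding uniqueness the increment of the sum is the increment of a single bump, scaled
  by one coefficient.\<close>

lemma bump_sum_left_unif_cont:
  assumes M: "\<And>l. cmod (c l) \<le> M"
  shows "left_unif_cont (bump_sum c)"
  unfolding left_unif_cont_def
proof (intro allI impI)
  fix e :: real assume e: "e > 0"
  have M0: "M \<ge> 0"
    using M norm_ge_zero order_trans by blast
  have "e / (M + 1) > 0" using e M0 by simp
  then obtain V where V: "open V" "0 \<in> V" "\<And>v y. v \<in> V \<Longrightarrow> cmod (h (v + y) - h y) < e / (M + 1)"
    using h_left_unif_cont unfolding left_unif_cont_def by meson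
  have "cmod (bump_sum c (v + y) - bump_sum c y) < e" if v: "v \<in> V \<inter> interior U" for v y
  proof -
    have vU: "v \<in> U" using v interior_subset by blast
    show ?thesis
    proof (cases "\<exists>l\<in>L. - t l + y \<in> U \<or> - t l + (v + y) \<in> U")
      case True
      then obtain l where l: "l \<in> L" "- t l + y \<in> U \<or> - t l + (v + y) \<in> U" by blast
      have "bump_sum c y = c l * h (- t l + y)"
        by (rule bump_sum_single[OF l(1)]) (rule near_unique[OF _ l(1) vU _ l(2)], simp_all)
      moreover have "bump_sum c (v + y) = c l * h (- t l + (v + y))"
        by (rule bump_sum_single[OF l(1)]) (rule near_unique[OF _ l(1) vU _ l(2)], simp_all)
      moreover have "- t l + (v + y) = v + (- t l + y)"
        unfolding uminus_central[OF l(1)] by (simp only: group_word_simps)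
      ultimately have "cmod (bump_sum c (v + y) - bump_sum c y)
          = cmod (c l) * cmod (h (v + (- t l + y)) - h (- t l + y))"
        by (simp only: norm_mult[symmetric] right_diff_distrib)
      also have "\<dots> \<le> M * (e / (M + 1))"
        using V(3)[of v "- t l + y"] v M M0 by (intro mult_mono) auto
      also have "\<dots> < e"
        using e M0 by (simp add: field_simps)
      finally show ?thesis .
    next
      case False
      then show ?thesis
        using bump_sum_outside[of y c] bump_sum_outside[of "v + y" c] e by simp
    qed
  qed
  then show "\<exists>V. open V \<and> 0 \<in> V \<and> (\<forall>v\<in>V. \<forall>y. cmod (bump_sum c (v + y) - bump_sum c y) < e)"
    using V(1,2) U_nhd by (intro exI[of _ "V \<inter> interior U"]) auto
qed

definition bump_series :: "('l \<Rightarrow> complex) \<Rightarrow> 'g \<Rightarrow>\<^sub>C complex" where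
  "bump_series c = Bcontfun (bump_sum c)"

lemma apply_bump_series:
  assumes "\<And>l. cmod (c l) \<le> M"
  shows "apply_bcontfun (bump_series c) = bump_sum c"
  unfolding bump_series_def
proof (intro Bcontfun_inverse bcontfun_normI)
  show "continuous_on UNIV (bump_sum c)"
    by (intro left_unif_cont_imp_continuous bump_sum_left_unif_cont[of c M] assms)
  show "cmod (bump_sum c x) \<le> M" for x
    by (intro norm_bump_sum_le assms)
qed

lemma norm_bump_series_le:
  assumes "\<And>l. cmod (c l) \<le> M"
  shows "norm (bump_series c) \<le> M"
  using norm_bump_sum_le[of c M, OF assms]
  by (intro norm_bound) (simp add: apply_bump_series[of c M, OF assms])

lemma bump_sum_add: "bump_sum (\<lambda>l. c l + d l) x = bump_sum c x + bump_sum d x"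
  by (simp add: bump_sum_def sum.distrib distrib_right)

lemma bump_sum_scale: "bump_sum (\<lambda>l. z * c l) x = z * bump_sum c x"
  by (simp add: bump_sum_def sum_distrib_left mult.assoc)

lemma bump_series_add:
  assumes "\<And>l. cmod (c l) \<le> M" "\<And>l. cmod (d l) \<le> N"
  shows "bump_series (\<lambda>l. c l + d l) = bump_series c + bump_series d"
proof (rule bcontfun_eqI)
  fix x
  have "cmod (c l + d l) \<le> M + N" for l
    using norm_triangle_mono[OF assms(1)[of l] assms(2)[of l]] .
  note apply_bump_series[of "\<lambda>l. c l + d l", OF this]
  then show "bump_series (\<lambda>l. c l + d l) x = (bump_series c + bump_series d) x"
    by (simp add: plus_bcontfun.rep_eq apply_bump_series[of c, OF assms(1)]
        apply_bump_series[of d, OF assms(2)] bump_sum_add)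
qed

lemma bump_series_scale:
  assumes "\<And>l. cmod (c l) \<le> M"
  shows "bump_series (\<lambda>l. z * c l) = cscale z (bump_series c)"
proof (rule bcontfun_eqI)
  fix x
  have "cmod (z * c l) \<le> cmod z * M" for l
    using mult_left_mono[OF assms[of l] norm_ge_zero[of z]] by (simp add: norm_mult)
  note apply_bump_series[of "\<lambda>l. z * c l", OF this]
  then show "bump_series (\<lambda>l. z * c l) x = cscale z (bump_series c) x"
    by (simp add: cscale.rep_eq apply_bump_series[of c, OF assms] bump_sum_scale)
qed

text \<open>This set carries the bump at \<open>t l\<close> after the whole sum is translated by \<open>s\<close>.\<close>

definition supp :: "'g \<Rightarrow> 'l \<Rightarrow> 'g set" where
  "supp s l = {u. - t l + (s + u) \<in> U}"

lemma compact_supp: "compact (supp s l)"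
proof -
  have "supp s l = (\<lambda>x. - s + (t l + x)) ` U"
  proof (intro set_eqI iffI)
    fix u assume "u \<in> supp s l"
    moreover have "u = - s + (t l + (- t l + (s + u)))" by (simp only: group_word_simps)
    ultimately show "u \<in> (\<lambda>x. - s + (t l + x)) ` U"
      unfolding supp_def by blast
  qed (auto simp: supp_def group_word_simps simp del: add_uminus_conv_diff)
  then show ?thesis
    using U_compact by (auto intro!: compact_continuous_image continuous_intros)
qed

definition overlap :: "'g set \<Rightarrow> 'g set" where
  "overlap A = \<Union>{supp s l | s l. s \<in> A \<and> l \<in> L \<and> (\<exists>s'\<in>A. s' \<noteq> s \<and> (\<exists>l'\<in>L. supp s l \<inter> supp s' l' \<noteq> {}))}"

text \<open>Only finitely many bumps are involved. If bumps \<open>l\<close> and \<open>l'\<close> of the translates by \<open>s\<close> and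
  \<open>s'\<close> meet, then \<open>t l - t l'\<close> lies in a compact set, and \<open>l = l'\<close> would force \<open>s - s'\<close> to be in
  \<open>U + U\<close>.\<close>

lemma overlap_compact:
  assumes "finite A" "pairwise far A"
  shows "compact (overlap A)"
proof -
  have fin: "finite {l \<in> L. \<exists>l'\<in>L. supp s l \<inter> supp s' l' \<noteq> {}}" (is "finite ?Q")
    if s: "s \<in> A" "s' \<in> A" "s' \<noteq> s" for s s'
  proof -
    let ?C = "{- a + ((s - s') + b) | a b. a \<in> U \<and> b \<in> U}"
    let ?P = "{(l, l'). l \<in> L \<and> l' \<in> L \<and> l \<noteq> l' \<and> t l - t l' \<in> ?C}"
    have "compact ?C"
      by (rule compact_image2[OF U_compact U_compact])
        (auto simp: case_prod_unfold intro!: continuous_intros)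
    then have "finite (fst ` ?P)"
      by (intro finite_imageI locally_finite)
    moreover have "?Q \<subseteq> fst ` ?P"
    proof
      fix l assume "l \<in> ?Q"
      then obtain l' u where l: "l \<in> L" "l' \<in> L" "u \<in> supp s l" "u \<in> supp s' l'" by blast
      let ?a = "- t l + (s + u)" and ?b = "- t l' + (s' + u)"
      have ab: "?a \<in> U" "?b \<in> U" using l by (auto simp: supp_def)
      have "t l - t l' = - ?a + (- t l' + (s + u))"
        by (rule difference[OF l(1,2)])
      also have "- t l' + (s + u) = (s - s') + ?b"
        unfolding uminus_central[OF l(2)] by (simp only: group_word_simps)
      finally have eq: "t l - t l' = - ?a + ((s - s') + ?b)" .
      have "l \<noteq> l'"
      proof
        assume "l = l'"
        have "?a + - ?b \<in> UU"
          by (rule UU_I[OF ab(1) U_uminus[OF ab(2)]])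
        also have "?a + - ?b = s - s'"
          unfolding \<open>l = l'\<close> uminus_central[OF l(2)] by (simp only: group_word_simps)
        finally have "s - s' \<in> UU" .
        moreover have "far s s'"
          using pairwiseD[OF assms(2) s(1,2)] s(3) by simp
        ultimately show False by (simp add: far_def)
      qed
      moreover have "t l - t l' \<in> ?C"
        unfolding eq using ab by blast
      ultimately have "(l, l') \<in> ?P"
        using l(1,2) by simp
      then show "l \<in> fst ` ?P" by (rule rev_image_eqI) simp
    qed
    ultimately show ?thesis by (rule rev_finite_subset)
  qed
  have eq: "overlap A = (\<Union>s\<in>A. \<Union>s'\<in>A - {s}. \<Union>l\<in>{l \<in> L. \<exists>l'\<in>L. supp s l \<inter> supp s' l' \<noteq> {}}. supp s l)"
    unfolding overlap_def by (intro set_eqI iffI) blast+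
  show ?thesis
    unfolding eq using assms(1) by (intro compact_UN compact_supp fin finite_Diff) auto
qed

definition isolated :: "'g set \<Rightarrow> 'g \<Rightarrow> bool" where
  "isolated A r \<longleftrightarrow> (\<forall>l\<in>L. \<forall>l'\<in>L. supp r l \<inter> overlap A \<noteq> {} \<longrightarrow> supp r l' \<inter> overlap A \<noteq> {} \<longrightarrow> l = l')"

text \<open>If two bumps \<open>l\<close> and \<open>l'\<close> of the translate by \<open>r\<close> reach into the compact overlap, then
  \<open>t l - t l'\<close> lies in a compact set. This happens for finitely many pairs only, and for each pair
  the elements \<open>r\<close> in question form a relatively compact set.\<close>

lemma compact_not_isolated:
  assumes "finite A" "pairwise far A"
  shows "\<exists>K. compact K \<and> (\<forall>r. r \<notin> K \<longrightarrow> (\<forall>a\<in>A. far a r) \<and> isolated A r)"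
proof -
  let ?E = "overlap A"
  have E: "compact ?E" by (rule overlap_compact[OF assms])
  let ?D = "{- u' + u | u' u. u' \<in> ?E \<and> u \<in> ?E}"
  let ?B = "{- a + b | a b. a \<in> U \<and> b \<in> U}"
  let ?C = "{p + q | p q. p \<in> ?B \<and> q \<in> ?D}"
  have "compact ?B" "compact ?D"
    by (rule compact_image2[OF U_compact U_compact] compact_image2[OF E E],
        auto simp: case_prod_unfold intro!: continuous_intros)+
  then have "compact ?C"
    by (rule compact_image2) (auto simp: case_prod_unfold intro!: continuous_intros)
  then have fin: "finite {(l, l'). l \<in> L \<and> l' \<in> L \<and> l \<noteq> l' \<and> t l - t l' \<in> ?C}" (is "finite ?P")
    by (rule locally_finite)
  let ?N = "\<lambda>l. {t l + (a - u) | a u. a \<in> U \<and> u \<in> ?E}"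
  have "compact (?N l)" for l
    by (rule compact_image2[OF U_compact E]) (auto simp: case_prod_unfold intro!: continuous_intros)
  then have K2: "compact (\<Union>l\<in>fst ` ?P. ?N l)"
    using fin by (intro compact_UN) auto
  obtain K where K: "compact K" "\<And>r. r \<notin> K \<Longrightarrow> \<forall>a\<in>A. far a r"
    using compact_not_far[OF assms(1)] by blast
  have iso: "isolated A r" if r: "r \<notin> (\<Union>l\<in>fst ` ?P. ?N l)" for r
    unfolding isolated_def
  proof (intro ballI impI)
    fix l l' assume l: "l \<in> L" "l' \<in> L" and "supp r l \<inter> ?E \<noteq> {}" "supp r l' \<inter> ?E \<noteq> {}"
    then obtain u u' where u: "u \<in> ?E" "u' \<in> ?E" "- t l + (r + u) \<in> U" "- t l' + (r + u') \<in> U"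
      unfolding supp_def by blast
    let ?a = "- t l + (r + u)" and ?b = "- t l' + (r + u')"
    show "l = l'"
    proof (rule ccontr)
      assume "l \<noteq> l'"
      have "t l - t l' = - ?a + (- t l' + (r + u))"
        by (rule difference[OF l])
      also have "\<dots> = (- ?a + ?b) + (- u' + u)"
        by (simp only: group_word_simps)
      finally have "t l - t l' \<in> ?C"
        using u by blast
      then have "(l, l') \<in> ?P"
        using l \<open>l \<noteq> l'\<close> by simp
      then have "l \<in> fst ` ?P" by (rule rev_image_eqI) simp
      moreover have "r = t l + (?a - u)" by (simp only: group_word_simps)
      then have "r \<in> ?N l" using u by blast
      ultimately have "r \<in> (\<Union>l\<in>fst ` ?P. ?N l)" by (rule UN_I)
      with r show False ..
    qed
  qed
  show ?thesis
  proof (intro exI[of _ "K \<union> (\<Union>l\<in>fst ` ?P. ?N l)"] conjI allI impI)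
    show "compact (K \<union> (\<Union>l\<in>fst ` ?P. ?N l))"
      by (rule compact_Un[OF K(1) K2])
    fix r assume "r \<notin> K \<union> (\<Union>l\<in>fst ` ?P. ?N l)"
    then have r: "r \<notin> K" "r \<notin> (\<Union>l\<in>fst ` ?P. ?N l)" by (auto simp only: Un_iff)
    show "\<forall>a\<in>A. far a r" by (rule K(2)[OF r(1)])
    show "isolated A r" by (rule iso[OF r(2)])
  qed
qed

definition cut :: "('l \<Rightarrow> complex) \<Rightarrow> 'l set \<Rightarrow> 'l \<Rightarrow> complex" where
  "cut c X l = (if l \<in> X then c l else 0)"

text \<open>The orbit of the sum, together with the weakly compact set of scaled translates of a single
  bump, is weakly compact. It has to be shown that far out in the group the translates are weakly
  close to a scaled translate of one bump. Otherwise there is a sequence \<open>s\<close> of translations, as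
  far apart as desired, that violates this for one weak neighbourhood. Split the \<open>k\<close>th translate into
  three parts: the bump \<open>x k\<close>, if any, that reaches into the overlap of the earlier translates; the
  other bumps \<open>d k\<close> that meet an earlier translate; and the remaining bumps \<open>r k\<close>. The functions
  \<open>r k\<close> have disjoint supports by definition, and so do the functions \<open>d k\<close>, because \<open>d j\<close> lives
  in the overlap from which \<open>d k\<close> was removed. So some \<open>d k + r k\<close> is small for all functionals
  of the neighbourhood, a contradiction.\<close>

lemma bump_series_in_WAP:
  assumes M: "\<And>l. cmod (c l) \<le> M"
  shows "bump_series c \<in> WAP"
proof -
  let ?f = "bump_series c"
  have M0: "M \<ge> 0"
    using M norm_ge_zero order_trans by blast
  have cut: "cmod (cut c X l) \<le> M" for X l
    using M M0 by (simp add: cut_def)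
  have translate: "left_translate s (bump_series (cut c X)) u = bump_sum (cut c X) (s + u)" for s X u
    by (simp add: left_translate.rep_eq apply_bump_series[of "cut c X" M, OF cut])
  have "compactin weak_topology (bump_translates M \<union> range (\<lambda>s. left_translate s ?f))"
  proof (rule weakly_compact_Un[OF bump_translates_weakly_compact[OF M0]])
    fix \<Phi> :: "(('g \<Rightarrow>\<^sub>C complex) \<Rightarrow> complex) set" and e :: real
    assume \<Phi>: "finite \<Phi>" "\<And>\<phi>. \<phi> \<in> \<Phi> \<Longrightarrow> cfunctional \<phi>" and e: "e > 0"
    define S where "S = {s. \<forall>f \<in> bump_translates M. left_translate s ?f \<notin> weak_nhd \<Phi> e f}"
    have "\<exists>K. compact K \<and> S \<subseteq> K"
    proof (rule ccontr)
      assume S: "\<not> ?thesis"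
      have "\<exists>s :: nat \<Rightarrow> 'g. \<forall>k. s k \<in> S \<and> (\<forall>j<k. far (s j) (s k)) \<and> isolated (s ` {..<k}) (s k)"
      proof (rule escaping_sequence)
        show "\<not> S \<subseteq> K" if "compact K" for K
          using S that by blast
        show "far b a" if "far a b" for a b
          using that by (rule far_sym)
      qed (rule compact_not_isolated)
      then obtain s :: "nat \<Rightarrow> 'g" where s: "\<And>k. s k \<in> S" "\<And>j k. j < k \<Longrightarrow> far (s j) (s k)"
          "\<And>k. isolated (s ` {..<k}) (s k)"
        by blast
      define X where "X k = {l \<in> L. supp (s k) l \<inter> overlap (s ` {..<k}) \<noteq> {}}" for k
      define D where "D k = {l \<in> L - X k. \<exists>j<k. \<exists>l'\<in>L. supp (s k) l \<inter> supp (s j) l' \<noteq> {}}" for k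
      define R where "R k = L - X k - D k" for k
      define x where "x k = left_translate (s k) (bump_series (cut c (X k)))" for k
      define d where "d k = left_translate (s k) (bump_series (cut c (D k)))" for k
      define r where "r k = left_translate (s k) (bump_series (cut c (R k)))" for k
      have decomp: "left_translate (s k) ?f = x k + d k + r k" for k
      proof (rule bcontfun_eqI)
        fix u
        have "bump_sum c (s k + u) = bump_sum (\<lambda>l. cut c (X k) l + cut c (D k) l + cut c (R k) l) (s k + u)"
          unfolding bump_sum_def
          by (rule sum.cong) (auto simp: cut_def R_def D_def X_def)
        then show "left_translate (s k) ?f u = (x k + d k + r k) u"
          by (simp add: plus_bcontfun.rep_eq x_def d_def r_def translate bump_sum_add
              left_translate.rep_eq[of _ ?f] apply_bump_series[of c M, OF M])
      qed
      have supp: "\<exists>l \<in> L \<inter> Y. u \<in> supp (s k) l"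
        if "left_translate (s k) (bump_series (cut c Y)) u \<noteq> 0" for k Y u
        using that unfolding translate supp_def
        by (elim bump_sum_nonzero) (auto simp: cut_def split: if_splits)
      have "r j u = 0 \<or> r k u = 0" if "j < k" for j k u
      proof (rule ccontr)
        assume "\<not> ?thesis"
        then obtain l l' where "l \<in> L \<inter> R k" "u \<in> supp (s k) l" "l' \<in> L" "u \<in> supp (s j) l'"
          using supp[of k "R k" u] supp[of j "R j" u] unfolding r_def by blast
        then show False using that unfolding R_def D_def by blast
      qed
      moreover have "d j u = 0 \<or> d k u = 0" if jk: "j < k" for j k u
      proof (rule ccontr)
        assume "\<not> ?thesis"
        then obtain l l' where l: "l \<in> D k" "u \<in> supp (s k) l" "l' \<in> D j" "u \<in> supp (s j) l'"
          using supp[of k "D k" u] supp[of j "D j" u] unfolding d_def by blast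
        then obtain i l'' where i: "i < j" "l'' \<in> L" "supp (s j) l' \<inter> supp (s i) l'' \<noteq> {}"
          unfolding D_def by blast
        have "s i \<noteq> s j" "s i \<in> s ` {..<k}" "s j \<in> s ` {..<k}" "l' \<in> L"
          using far_neq[OF s(2)[OF i(1)]] i(1) jk l(3) by (auto simp: D_def)
        then have "supp (s j) l' \<subseteq> overlap (s ` {..<k})"
          unfolding overlap_def using i by blast
        then show False
          using l unfolding D_def X_def by blast
      qed
      moreover have "cmod (d k u) \<le> M" "cmod (r k u) \<le> M" for k u
        unfolding d_def r_def translate by (rule norm_bump_sum_le[OF cut])+
      ultimately obtain k where k: "\<forall>\<phi>\<in>\<Phi>. cmod (\<phi> (d k)) + cmod (\<phi> (r k)) < e"
        using disjoint_families_small[OF \<Phi> e, of d M r] by blast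
      have "x k \<in> bump_translates M"
      proof (cases "X k = {}")
        case True
        then have "x k = cscale 0 (left_translate 0 bcont_h)"
          by (intro bcontfun_eqI) (simp add: x_def translate cut_def bump_sum_def cscale.rep_eq)
        then show ?thesis
          unfolding bump_translates_def using M0 by force
      next
        case False
        then obtain l where "l \<in> X k" by blast
        then have X: "X k = {l}" "l \<in> L"
          using s(3)[of k] unfolding isolated_def X_def by auto
        have "x k = cscale (c l) (left_translate (- t l + s k) bcont_h)"
        proof (rule bcontfun_eqI)
          fix u
          have "bump_sum (cut c {l}) (s k + u) = c l * h (- t l + (s k + u))"
          proof (cases "\<exists>l'\<in>L. - t l' + (s k + u) \<in> U")
            case True
            then obtain l' where l': "l' \<in> L" "- t l' + (s k + u) \<in> U" by blast
            show ?thesis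
              unfolding bump_sum_at[OF l'] using bump_unique[OF X(2) l'(1) _ l'(2)] h_support
              by (auto simp: cut_def)
          next
            case False
            then show ?thesis
              using bump_sum_outside[of "s k + u"] h_support X(2) by fastforce
          qed
          then show "x k u = cscale (c l) (left_translate (- t l + s k) bcont_h) u"
            by (simp add: x_def translate X(1) cscale.rep_eq left_translate.rep_eq[of _ bcont_h] add.assoc)
        qed
        then show ?thesis
          unfolding bump_translates_def using M by blast
      qed
      moreover have "left_translate (s k) ?f \<in> weak_nhd \<Phi> e (x k)"
        unfolding weak_nhd_def
      proof (intro CollectI ballI)
        fix \<phi> assume \<phi>: "\<phi> \<in> \<Phi>"
        then interpret \<phi>: bounded_linear \<phi>
          using \<Phi>(2) by (simp add: cfunctional_def)
        have "\<phi> (left_translate (s k) ?f) - \<phi> (x k) = \<phi> (d k) + \<phi> (r k)"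
          by (simp add: decomp \<phi>.add)
        then show "cmod (\<phi> (left_translate (s k) ?f) - \<phi> (x k)) < e"
          using k \<phi> norm_triangle_ineq[of "\<phi> (d k)" "\<phi> (r k)"] by fastforce
      qed
      ultimately show False
        using s(1)[of k] unfolding S_def by blast
    qed
    then obtain K where K: "compact K" "S \<subseteq> K" by blast
    have "compact ((\<lambda>s. left_translate s ?f) ` K)"
      using K(1) bump_sum_left_unif_cont[of c M, OF M]
      by (intro compact_continuous_image continuous_on_subset[OF left_unif_cont_translate_continuous])
        (auto simp: apply_bump_series[of c M, OF M])
    moreover have "\<forall>g \<in> range (\<lambda>s. left_translate s ?f) - (\<lambda>s. left_translate s ?f) ` K.
        \<exists>f\<in>bump_translates M. g \<in> weak_nhd \<Phi> e f"
      using K(2) unfolding S_def by blast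
    ultimately show "\<exists>C \<subseteq> range (\<lambda>s. left_translate s ?f). compact C \<and>
        (\<forall>g \<in> range (\<lambda>s. left_translate s ?f) - C. \<exists>f\<in>bump_translates M. g \<in> weak_nhd \<Phi> e f)"
      by (intro exI[of _ "(\<lambda>s. left_translate s ?f) ` K"]) auto
  qed
  then show ?thesis
    unfolding WAP_def by (auto intro: relatively_weakly_compact_subset)
qed

end


section \<open>Generic grids in commutative groups\<close>

text \<open>\<open>combos k Q\<close> contains the signed sums of at most \<open>2 ^ k\<close> elements of \<open>Q\<close>. Sums of bounded
  length are used instead of the generated subgroup, because a finite \<open>Q\<close> must yield a
  finite set.\<close>

primrec combos :: "nat \<Rightarrow> 'a::ab_group_add set \<Rightarrow> 'a set" where
  "combos 0 Q = insert 0 (Q \<union> uminus ` Q)"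
| "combos (Suc k) Q = (\<lambda>(x, y). x + y) ` (combos k Q \<times> combos k Q)"

lemma combos_zero: "0 \<in> combos k Q"
  by (induction k) force+

lemma combos_uminus: "x \<in> combos k Q \<Longrightarrow> - x \<in> combos k Q"
proof (induction k arbitrary: x)
  case (Suc k)
  then obtain y z where "x = y + z" "y \<in> combos k Q" "z \<in> combos k Q" by auto
  with Suc.IH have "- x = - y + - z" "- y \<in> combos k Q" "- z \<in> combos k Q" by auto
  then show ?case by force
qed auto

lemma combos_add_Suc: "x \<in> combos k Q \<Longrightarrow> y \<in> combos k Q \<Longrightarrow> x + y \<in> combos (Suc k) Q"
  by force

lemma combos_le: "k \<le> l \<Longrightarrow> combos k Q \<subseteq> combos l Q"
proof (induction rule: dec_induct)
  case (step l)
  have "combos l Q \<subseteq> combos (Suc l) Q"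
    using combos_add_Suc[OF _ combos_zero, of _ l Q] by auto
  with step show ?case by blast
qed simp

lemma combos_add: "x \<in> combos k Q \<Longrightarrow> y \<in> combos k Q \<Longrightarrow> k < l \<Longrightarrow> x + y \<in> combos l Q"
  using combos_add_Suc combos_le[of "Suc k" l Q] by (metis Suc_leI subsetD)

lemma combos_mono: "Q \<subseteq> Q' \<Longrightarrow> combos k Q \<subseteq> combos k Q'"
  by (induction k) fastforce+

lemma card_of_finite_less_infinite:
  assumes "finite A" "infinite B"
  shows "|A| <o |B|"
proof -
  have "|A| <o natLeq" "natLeq \<le>o |B|"
    using assms finite_iff_ordLess_natLeq infinite_iff_natLeq_ordLeq by blast+
  then show ?thesis by (rule ordLess_ordLeq_trans)
qed

lemma card_of_combos_less:
  fixes Q :: "'a::ab_group_add set"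
  assumes I: "infinite I" and Q: "|Q| <o |I|"
  shows "|combos k Q| <o |I|"
proof (induction k)
  case 0
  have "|uminus ` Q| <o |I|"
    using card_of_image Q ordLeq_ordLess_trans by blast
  moreover have "|{0 :: 'a}| <o |I|"
    using I by (simp add: card_of_finite_less_infinite)
  ultimately have "|{0} \<union> (Q \<union> uminus ` Q)| <o |I|"
    using I Q card_of_Un_ordLess_infinite by blast
  then show ?case by simp
next
  case (Suc k)
  have "|combos k Q \<times> combos k Q| <o |I|"
  proof (cases "finite (combos k Q)")
    case True
    then show ?thesis
      using I by (simp add: card_of_finite_less_infinite)
  next
    case False
    from ordIso_ordLess_trans[OF card_of_Times_same_infinite[OF this] Suc] show ?thesis .
  qed
  then show ?case
    unfolding combos.simps by (rule ordLeq_ordLess_trans[OF card_of_image])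
qed

declare combos.simps(2) [simp del]

text \<open>Transfinite recursion along a well-order of minimal type: fewer than \<open>|I|\<close> elements precede
  each index, so fewer than \<open>|I|\<close> translates of \<open>K\<close> have to be avoided.\<close>

lemma generators_exist:
  fixes K :: "'a::ab_group_add set" and I :: "'i set"
  assumes I: "infinite I"
    and avoid: "\<And>Q. |Q| <o |I| \<Longrightarrow> \<exists>z. \<forall>q\<in>Q. z - q \<notin> K"
  shows "\<exists>c. \<forall>i\<in>I. \<forall>q \<in> combos 4 (c ` underS |I| i). c i - q \<notin> K"
proof -
  let ?P = "\<lambda>c i z. i \<in> I \<longrightarrow> (\<forall>q \<in> combos 4 (c ` underS |I| i). z - q \<notin> K)"
  have "wf ( |I| - Id)"
    using card_of_Well_order by (auto simp: well_order_on_def)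
  moreover have "?P f i r = ?P g i r" if "\<And>z. (z, i) \<in> |I| - Id \<Longrightarrow> f z = g z" for f g i r
  proof -
    have "f ` underS |I| i = g ` underS |I| i"
      using that by (intro image_cong) (auto simp: underS_def)
    then show ?thesis by simp
  qed
  moreover have "\<exists>z. ?P c i z" for c i
  proof (cases "i \<in> I")
    case True
    then have "|underS |I| i| <o |I|"
      using card_of_underS[OF card_of_Card_order, of i I] by (simp add: Field_card_of)
    then have "|c ` underS |I| i| <o |I|"
      using card_of_image ordLeq_ordLess_trans by blast
    from avoid[OF card_of_combos_less[OF I this]] show ?thesis by blast
  qed simp
  ultimately have "\<exists>c. \<forall>i. ?P c i (c i)"
    by (rule dependent_wf_choice)
  then obtain c where "\<forall>i. ?P c i (c i)" ..
  then show ?thesis by (intro exI[of _ c]) simp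
qed

locale independent_generators =
  fixes c :: "'i \<Rightarrow> 'a::ab_group_add" and r :: "'i rel" and K :: "'a set"
  assumes wo: "Well_order r"
    and K_uminus: "x \<in> K \<Longrightarrow> - x \<in> K"
    and independent: "i \<in> Field r \<Longrightarrow> q \<in> combos 4 (c ` underS r i) \<Longrightarrow> c i - q \<notin> K"
begin

text \<open>\<open>leads i x\<close>: in \<open>x\<close> the last generator \<open>c i\<close> occurs with coefficient \<open>1\<close> or \<open>- 1\<close>, accompanied
  by few earlier ones. Larger coefficients are excluded since the multiples of \<open>c i\<close> are not under
  control; in a group of exponent two, for instance, \<open>c i + c i\<close> is zero.\<close>

definition leads :: "'i \<Rightarrow> 'a \<Rightarrow> bool" where
  "leads i x \<longleftrightarrow> (\<exists>w \<in> combos 2 (c ` underS r i). x = c i + w \<or> x = - (c i + w))"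

lemma leads_uminus: "leads i x \<Longrightarrow> leads i (- x)"
  unfolding leads_def by (metis minus_minus)

lemma leads_notin:
  assumes "i \<in> Field r" "leads i x"
  shows "x \<notin> K"
proof -
  obtain w where w: "w \<in> combos 2 (c ` underS r i)" "x = c i + w \<or> x = - (c i + w)"
    using assms(2) by (auto simp: leads_def)
  have "- w \<in> combos 4 (c ` underS r i)"
    using combos_uminus[OF w(1)] combos_le[of 2 4] by auto
  from independent[OF assms(1) this] have "c i + w \<notin> K" by simp
  then show ?thesis
    using w(2) K_uminus by (metis minus_minus)
qed

lemma underS_mono:
  assumes "i \<in> underS r j"
  shows "underS r i \<subseteq> underS r j"
  using assms wo unfolding underS_def order_on_defs
  by (smt (verit, best) antisymD mem_Collect_eq subsetI transD)

text \<open>If \<open>y - x\<close> were in \<open>K\<close>, then \<open>c j\<close> would differ from a short combination of earlier generators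
  by an element of \<open>K\<close>.\<close>

lemma leads_less:
  assumes "i \<in> underS r j" "j \<in> Field r" "leads i x" "leads j y"
  shows "y - x \<notin> K"
proof
  assume K: "y - x \<in> K"
  let ?Q = "c ` underS r j"
  obtain w where w: "w \<in> combos 2 (c ` underS r i)" "x = c i + w \<or> x = - (c i + w)"
    using assms(3) by (auto simp: leads_def)
  obtain w' where w': "w' \<in> combos 2 ?Q" "y = c j + w' \<or> y = - (c j + w')"
    using assms(4) by (auto simp: leads_def)
  have "w \<in> combos 2 ?Q"
    using w(1) underS_mono[OF assms(1)] combos_mono by (metis image_mono subsetD)
  moreover have "c i \<in> combos 2 ?Q"
    using assms(1) combos_le[of 0 2 ?Q] by auto
  ultimately have "c i + w \<in> combos 3 ?Q"
    using combos_add[of "c i" 2 ?Q w 3] by simp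
  then have x: "x \<in> combos 3 ?Q" "- x \<in> combos 3 ?Q"
    using w(2) combos_uminus by (metis minus_minus)+
  have "- w' \<in> combos 3 ?Q"
    using combos_uminus[OF w'(1)] combos_le[of 2 3] by auto
  then have *: "x + - w' \<in> combos 4 ?Q" "- x + - w' \<in> combos 4 ?Q"
    using combos_add[of _ 3 ?Q "- w'" 4] x by simp_all
  show False
    using w'(2)
  proof
    assume "y = c j + w'"
    then show False using independent[OF assms(2) *(1)] K by (simp add: algebra_simps)
  next
    assume y: "y = - (c j + w')"
    have "- (y - x) = c j - (- x + - w')" using y by (simp add: algebra_simps)
    then show False using independent[OF assms(2) *(2)] K_uminus[OF K] by metis
  qed
qed

lemma underS_total:
  assumes "i \<in> Field r" "j \<in> Field r" "i \<noteq> j"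
  shows "i \<in> underS r j \<or> j \<in> underS r i"
  using assms wo unfolding underS_def order_on_defs total_on_def by auto

lemma leads_unique:
  assumes "i \<in> Field r" "j \<in> Field r" "leads i x" "leads j y" "y - x \<in> K"
  shows "i = j"
proof (rule ccontr)
  assume "i \<noteq> j"
  with underS_total[OF assms(1,2)] show False
    using leads_less[of i j x y] leads_less[of j i y x] assms K_uminus[OF assms(5)] by auto
qed

lemma finite_max:
  assumes "finite A" "A \<noteq> {}" "A \<subseteq> Field r"
  shows "\<exists>m\<in>A. \<forall>i\<in>A. i = m \<or> i \<in> underS r m"
  using assms
proof (induction A rule: finite_ne_induct)
  case (insert i A)
  then obtain m where m: "m \<in> A" "\<forall>j\<in>A. j = m \<or> j \<in> underS r m" by blast
  consider "m \<in> underS r i" | "i \<in> underS r m" | "i = m"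
    using underS_total[of i m] m insert.prems by blast
  then show ?case
    using m underS_mono[of m i] by cases auto
qed simp

lemma leads_diff:
  assumes "i \<in> Field r" "j \<in> Field r" "i \<noteq> j"
  shows "\<exists>m\<in>{i, j}. leads m (c i - c j)"
proof -
  have *: "leads k (c k - c l)" if "l \<in> underS r k" for k l
  proof -
    have "- c l \<in> combos 2 (c ` underS r k)"
      using that combos_le[of 0 2 "c ` underS r k"] by auto
    then show ?thesis unfolding leads_def by (metis diff_conv_add_uminus)
  qed
  show ?thesis
    using underS_total[OF assms] *[of j i] *[of i j] leads_uminus[of j "c j - c i"] by auto
qed

lemma leads_diff2:
  assumes "{i, j, k, l} \<subseteq> Field r" "distinct [i, j, k, l]"
  shows "\<exists>m\<in>{i, j, k, l}. leads m ((c i + c j) - (c k + c l))"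
proof -
  have *: "leads m (c m + c j - (c k + c l))"
    if "{j, k, l} \<subseteq> underS r m" for m j k l
  proof -
    let ?Q = "c ` underS r m"
    have 0: "c j \<in> combos 0 ?Q" "- c k \<in> combos 0 ?Q" "- c l \<in> combos 0 ?Q"
      using that by auto
    have "c j \<in> combos 1 ?Q"
      using 0 combos_le[of 0 1 ?Q] by auto
    moreover have "- c k + - c l \<in> combos 1 ?Q"
      using combos_add[OF 0(2,3), of 1] by simp
    ultimately have "c j + (- c k + - c l) \<in> combos 2 ?Q"
      using combos_add[of "c j" 1 ?Q _ 2] by simp
    then show ?thesis
      unfolding leads_def by (intro bexI[of _ "c j + (- c k + - c l)"]) (auto simp: algebra_simps)
  qed
  obtain m where m: "m \<in> {i, j, k, l}" "\<forall>n\<in>{i, j, k, l}. n = m \<or> n \<in> underS r m"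
    using finite_max[OF _ _ assms(1)] by auto
  from m(1) consider "m = i" | "m = j" | "m = k" | "m = l" by blast
  then have "leads m ((c i + c j) - (c k + c l))"
  proof cases
    case 1
    then show ?thesis using m(2) assms(2) *[of j k l m] by auto
  next
    case 2
    then show ?thesis using m(2) assms(2) *[of i k l m] by (auto simp: algebra_simps)
  next
    case 3
    then have "leads m (- (c m + c l - (c i + c j)))"
      using m(2) assms(2) by (intro leads_uminus *) auto
    then show ?thesis using 3 by (simp add: algebra_simps)
  next
    case 4
    then have "leads m (- (c m + c k - (c i + c j)))"
      using m(2) assms(2) by (intro leads_uminus *) auto
    then show ?thesis using 4 by (simp add: algebra_simps)
  qed
  with m(1) show ?thesis by blast
qed

end

definition grid_index :: "'i set \<Rightarrow> ('i \<times> nat \<times> nat \<times> nat) set" where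
  "grid_index I = {(\<alpha>, n, i, j). \<alpha> \<in> I \<and> i < n \<and> j < n}"

definition grid :: "('i \<Rightarrow> nat \<Rightarrow> nat \<Rightarrow> 'a::plus) \<Rightarrow> ('i \<Rightarrow> nat \<Rightarrow> nat \<Rightarrow> 'a) \<Rightarrow>
    'i \<times> nat \<times> nat \<times> nat \<Rightarrow> 'a" where
  "grid a b = (\<lambda>(\<alpha>, n, i, j). a \<alpha> n i + b \<alpha> n j)"

text \<open>The generators are relabelled by \<open>I \<times> nat \<times> nat \<times> bool\<close>, which is no larger than \<open>I\<close>, so that
  each grid of each index \<open>\<alpha>\<close> has generators of its own for its rows and its columns. In a difference
  of two distinct grid points the common generators cancel and the others have coefficient \<open>1\<close> or
  \<open>- 1\<close>, so the difference has a leading generator. Differences that agree up to \<open>K\<close> have the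
  same leading generator \<open>m\<close>. One of the two points then lies on the row or column of \<open>m\<close>, which
  leaves finitely many choices, and it determines the other point.\<close>

lemma separated_grid_exists:
  fixes K :: "'a::ab_group_add set" and I :: "'i set"
  assumes I: "infinite I" and K_uminus: "\<And>x. x \<in> K \<Longrightarrow> - x \<in> K"
    and avoid: "\<And>Q. |Q| <o |I| \<Longrightarrow> \<exists>z. \<forall>q\<in>Q. z - q \<notin> K"
  obtains a b :: "'i \<Rightarrow> nat \<Rightarrow> nat \<Rightarrow> 'a" where
    "\<forall>l \<in> grid_index I. \<forall>l' \<in> grid_index I. l \<noteq> l' \<longrightarrow> grid a b l - grid a b l' \<notin> K"
    "\<forall>D. (\<forall>x\<in>D. \<forall>y\<in>D. x - y \<in> K) \<longrightarrow>
       finite {(l, l'). l \<in> grid_index I \<and> l' \<in> grid_index I \<and> l \<noteq> l' \<and> grid a b l - grid a b l' \<in> D}"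
proof -
  obtain c :: "'i \<Rightarrow> 'a" where c: "\<forall>i\<in>I. \<forall>q \<in> combos 4 (c ` underS |I| i). c i - q \<notin> K"
    using generators_exist[OF I avoid] by blast
  interpret independent_generators c "|I|" K
  proof
    show "Well_order |I|" by (rule card_of_Well_order)
    show "c i - q \<notin> K" if "i \<in> Field |I|" "q \<in> combos 4 (c ` underS |I| i)" for i q
      using c that by (simp add: Field_card_of)
  qed (rule K_uminus)
  have "|UNIV :: (nat \<times> nat \<times> bool) set| \<le>o |UNIV :: nat set|"
    by (rule card_of_ordLeqI[OF inj_to_nat]) simp
  moreover have "|UNIV :: nat set| \<le>o |I|"
    using I infinite_iff_card_of_nat by blast
  ultimately have "|UNIV :: (nat \<times> nat \<times> bool) set| \<le>o |I|"
    by (rule ordLeq_transitive)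
  then have "|I \<times> (UNIV :: (nat \<times> nat \<times> bool) set)| =o |I|"
    using card_of_Times_infinite[OF I, of "UNIV :: (nat \<times> nat \<times> bool) set"] by simp
  then have "|I \<times> (UNIV :: (nat \<times> nat \<times> bool) set)| \<le>o |I|"
    by (rule ordIso_imp_ordLeq)
  then obtain \<rho> :: "'i \<times> nat \<times> nat \<times> bool \<Rightarrow> 'i"
    where \<rho>: "inj_on \<rho> (I \<times> UNIV)" "\<rho> ` (I \<times> UNIV) \<subseteq> I"
    unfolding card_of_ordLeq[symmetric] by blast
  define a where "a \<alpha> n i = c (\<rho> (\<alpha>, n, i, False))" for \<alpha> n i
  define b where "b \<alpha> n j = c (\<rho> (\<alpha>, n, j, True))" for \<alpha> n j
  define gens where "gens = (\<lambda>(\<alpha>, n, i, j). {\<rho> (\<alpha>, n, i, False), \<rho> (\<alpha>, n, j, True)})"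
  let ?L = "grid_index I" and ?t = "grid a b"
  have \<rho>I: "\<rho> (\<alpha>, p) \<in> I" if "\<alpha> \<in> I" for \<alpha> p
    using that \<rho>(2) by blast
  have \<rho>_eq: "\<rho> (\<alpha>, p) = \<rho> (\<alpha>', p') \<longleftrightarrow> \<alpha> = \<alpha>' \<and> p = p'" if "\<alpha> \<in> I" "\<alpha>' \<in> I" for \<alpha> \<alpha>' p p'
    using that inj_onD[OF \<rho>(1), of "(\<alpha>, p)" "(\<alpha>', p')"] by auto
  have lead: "\<exists>m \<in> I \<inter> (gens l \<union> gens l'). leads m (?t l - ?t l')"
    if l: "l \<in> ?L" and l': "l' \<in> ?L" and "l \<noteq> l'" for l l'
  proof -
    obtain \<alpha> n i j where 1: "l = (\<alpha>, n, i, j)" "\<alpha> \<in> I"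
      using l by (auto simp: grid_index_def)
    obtain \<alpha>' n' i' j' where 2: "l' = (\<alpha>', n', i', j')" "\<alpha>' \<in> I"
      using l' by (auto simp: grid_index_def)
    let ?p = "\<rho> (\<alpha>, n, i, False)" and ?q = "\<rho> (\<alpha>, n, j, True)"
    let ?p' = "\<rho> (\<alpha>', n', i', False)" and ?q' = "\<rho> (\<alpha>', n', j', True)"
    have mem: "?p \<in> I" "?q \<in> I" "?p' \<in> I" "?q' \<in> I"
      using 1 2 \<rho>I by blast+
    have t: "?t l - ?t l' = c ?p + c ?q - (c ?p' + c ?q')"
      by (simp add: 1 2 grid_def a_def b_def)
    consider "?p = ?p'" "?q \<noteq> ?q'" | "?q = ?q'" "?p \<noteq> ?p'" | "?p \<noteq> ?p'" "?q \<noteq> ?q'"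
      using \<open>l \<noteq> l'\<close> 1 2 \<rho>_eq by fastforce
    then show ?thesis
    proof cases
      case 1
      then show ?thesis
        using leads_diff[of ?q ?q'] mem t unfolding gens_def \<open>l = _\<close> \<open>l' = _\<close> by (auto simp: Field_card_of)
    next
      case 2
      then show ?thesis
        using leads_diff[of ?p ?p'] mem t unfolding gens_def \<open>l = _\<close> \<open>l' = _\<close> by (auto simp: Field_card_of)
    next
      case 3
      then have "distinct [?p, ?q, ?p', ?q']"
        using 1 2 \<rho>_eq by auto
      then show ?thesis
        using leads_diff2[of ?p ?q ?p' ?q'] mem t unfolding gens_def \<open>l = _\<close> \<open>l' = _\<close>
        by (auto simp: Field_card_of)
    qed
  qed
  have fin_gens: "finite {l \<in> ?L. m \<in> gens l}" for m
  proof (cases "\<exists>l0 \<in> ?L. m \<in> gens l0")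
    case True
    then obtain \<alpha> n k s where m: "\<alpha> \<in> I" "m = \<rho> (\<alpha>, n, k, s)"
      by (auto simp: grid_index_def gens_def)
    have "{l \<in> ?L. m \<in> gens l} \<subseteq> {\<alpha>} \<times> {n} \<times> {..<n} \<times> {..<n}"
      using m \<rho>_eq by (auto simp: grid_index_def gens_def)
    then show ?thesis by (rule finite_subset) auto
  next
    case False
    then have "{l \<in> ?L. m \<in> gens l} = {}" by blast
    then show ?thesis by (metis finite.emptyI)
  qed
  have sep: "?t l - ?t l' \<notin> K" if "l \<in> ?L" "l' \<in> ?L" "l \<noteq> l'" for l l'
    using lead[OF that] leads_notin by (auto simp: Field_card_of)
  have "finite {(l, l'). l \<in> ?L \<and> l' \<in> ?L \<and> l \<noteq> l' \<and> ?t l - ?t l' \<in> D}" (is "finite ?R")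
    if D: "\<And>x y. x \<in> D \<Longrightarrow> y \<in> D \<Longrightarrow> x - y \<in> K" for D
  proof (cases "?R = {}")
    case False
    then obtain l0 l0' where "(l0, l0') \<in> ?R" by fast
    then obtain m where m: "m \<in> I" "leads m (?t l0 - ?t l0')" "?t l0 - ?t l0' \<in> D"
      using lead[of l0 l0'] by auto
    have R: "m \<in> gens l \<union> gens l'" if ll': "(l, l') \<in> ?R" for l l'
    proof -
      obtain m' where "m' \<in> I \<inter> (gens l \<union> gens l')" "leads m' (?t l - ?t l')"
        using lead[of l l'] ll' by auto
      moreover have "(?t l - ?t l') - (?t l0 - ?t l0') \<in> K"
        using D m(3) ll' by blast
      ultimately show ?thesis
        using leads_unique[of m m'] m by (auto simp: Field_card_of)
    qed
    let ?T = "{l \<in> ?L. m \<in> gens l}"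
    have inj_fst: "inj_on fst ?R"
    proof (rule inj_onI)
      fix p q assume pq: "p \<in> ?R" "q \<in> ?R" "fst p = fst q"
      obtain l l' l'' where [simp]: "p = (l, l')" "q = (l, l'')"
        using pq(3) by (cases p, cases q) simp
      have "?t l' - ?t l'' = (?t l - ?t l'') - (?t l - ?t l')" by simp
      also have "\<dots> \<in> K" using pq by (intro D) simp_all
      finally have K: "?t l' - ?t l'' \<in> K" .
      have "l' \<in> ?L" "l'' \<in> ?L" using pq by simp_all
      then have "l' = l''" using sep K by metis
      then show "p = q" by simp
    qed
    have 1: "finite (fst -` ?T \<inter> ?R)"
      by (rule finite_vimage_IntI[OF fin_gens inj_fst])
    have inj_snd: "inj_on snd ?R"
    proof (rule inj_onI)
      fix p q assume pq: "p \<in> ?R" "q \<in> ?R" "snd p = snd q"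
      obtain l l' l'' where [simp]: "p = (l, l'')" "q = (l', l'')"
        using pq(3) by (cases p, cases q) simp
      have "?t l - ?t l' = (?t l - ?t l'') - (?t l' - ?t l'')" by simp
      also have "\<dots> \<in> K" using pq by (intro D) simp_all
      finally have K: "?t l - ?t l' \<in> K" .
      have "l \<in> ?L" "l' \<in> ?L" using pq by simp_all
      then have "l = l'" using sep K by metis
      then show "p = q" by simp
    qed
    have 2: "finite (snd -` ?T \<inter> ?R)"
      by (rule finite_vimage_IntI[OF fin_gens inj_snd])
    have "?R \<subseteq> (fst -` ?T \<inter> ?R) \<union> (snd -` ?T \<inter> ?R)"
    proof
      fix p assume p: "p \<in> ?R"
      obtain l l' where "p = (l, l')" by (cases p)
      then show "p \<in> (fst -` ?T \<inter> ?R) \<union> (snd -` ?T \<inter> ?R)"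
        using R[of l l'] p by simp
    qed
    then show ?thesis
      using 1 2 by (rule finite_subset[OF _ finite_UnI])
  next
    case True
    show ?thesis by (simp only: True finite.emptyI)
  qed
  then have "\<forall>D. (\<forall>x\<in>D. \<forall>y\<in>D. x - y \<in> K) \<longrightarrow>
      finite {(l, l'). l \<in> ?L \<and> l' \<in> ?L \<and> l \<noteq> l' \<and> ?t l - ?t l' \<in> D}"
    by simp
  moreover have "\<forall>l \<in> ?L. \<forall>l' \<in> ?L. l \<noteq> l' \<longrightarrow> ?t l - ?t l' \<notin> K"
    by (intro ballI impI sep)
  ultimately show thesis by (rule that[rotated])
qed


section \<open>Grids in the centre and the isometry\<close>

text \<open>The centre as a commutative group of its own, to which the choice of generators applies.\<close>

typedef (overloaded) 'g center = "group_center :: 'g::group_add set"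
  morphisms center_elt Center
proof
  show "0 \<in> group_center" by (simp add: group_center_def)
qed

setup_lifting type_definition_center

lemma group_center_add:
  "x \<in> group_center \<Longrightarrow> y \<in> group_center \<Longrightarrow> x + y \<in> group_center"
  unfolding group_center_def mem_Collect_eq by (metis add.assoc)

lemma group_center_uminus:
  assumes "x \<in> group_center"
  shows "- x \<in> group_center"
  unfolding group_center_def
proof (intro CollectI allI)
  fix g
  have "- x + g = - x + (g + x) + - x" by (simp only: group_word_simps)
  also have "g + x = x + g" using assms by (simp add: group_center_def)
  also have "- x + (x + g) + - x = g + - x" by (simp only: group_word_simps)
  finally show "- x + g = g + - x" .
qed

instantiation center :: (group_add) ab_group_add
begin

lift_definition zero_center :: "'a center" is 0
  by (simp add: group_center_def)

lift_definition plus_center :: "'a center \<Rightarrow> 'a center \<Rightarrow> 'a center" is "(+)"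
  by (rule group_center_add)

lift_definition uminus_center :: "'a center \<Rightarrow> 'a center" is uminus
  by (rule group_center_uminus)

lift_definition minus_center :: "'a center \<Rightarrow> 'a center \<Rightarrow> 'a center" is "(-)"
  unfolding diff_conv_add_uminus by (intro group_center_add group_center_uminus)

instance
proof
  fix x y z :: "'a center"
  show "x + y + z = x + (y + z)" by transfer (rule add.assoc)
  show "x + y = y + x" by transfer (unfold group_center_def, blast)
  show "0 + x = x" by transfer simp
  show "- x + x = 0" by transfer simp
  show "x - y = x + - y" by transfer simp
qed

end

lemma center_elt_commute: "center_elt z + x = x + center_elt z"
  using center_elt[of z] unfolding group_center_def by blast

lemma closed_group_center: "closed (group_center :: 'g::{topological_group_add, t2_space} set)"
proof -
  have eq: "group_center = (\<Inter>g :: 'g. {z. z + g = g + z})"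
    by (auto simp: group_center_def)
  show ?thesis
    unfolding eq by (intro closed_INT ballI closed_Collect_eq continuous_intros)
qed

text \<open>A compact neighbourhood made symmetric, and Urysohn's lemma for it; locally compact Hausdorff
  spaces are completely regular.\<close>

lemma symmetric_bump_exists:
  assumes "locally_compact_space (euclidean :: 'g::{topological_group_add, t2_space} topology)"
  obtains U :: "'g::{topological_group_add, t2_space} set" and h where "bump U h"
proof -
  obtain V C :: "'g set" where VC: "open V" "compact C" "0 \<in> V" "V \<subseteq> C"
    using bspec[OF assms[unfolded locally_compact_space_def], of 0] by auto
  define U where "U = C \<union> uminus ` C"
  have "Hausdorff_space (euclidean :: 'g topology)"
    unfolding Hausdorff_space_def disjnt_def
  proof (intro allI impI)
    fix x y :: 'g
    assume "x \<in> topspace euclidean \<and> y \<in> topspace euclidean \<and> x \<noteq> y"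
    then have "x \<noteq> y" by simp
    from hausdorff[OF this]
    show "\<exists>U V. openin euclidean U \<and> openin euclidean V \<and> x \<in> U \<and> y \<in> V \<and> U \<inter> V = {}"
      by (simp only: open_openin[symmetric])
  qed
  then have "completely_regular_space (euclidean :: 'g topology)"
    by (intro locally_compact_regular_imp_completely_regular_space assms disjI1)
  moreover have "closedin euclidean (- V)" "0 \<in> topspace euclidean - (- V)"
    using VC by auto
  ultimately obtain f :: "'g \<Rightarrow> real" where f: "continuous_map euclidean (top_of_set {0..1}) f"
      "f 0 = 0" "f ` (- V) \<subseteq> {1}"
    unfolding completely_regular_space_def by blast
  have cont: "continuous_on UNIV f" and range: "f x \<in> {0..1}" for x
    using f(1) by (auto simp: continuous_map_in_subtopology)
  show thesis
  proof (rule that)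
    show "bump U (\<lambda>x. complex_of_real (1 - f x))"
    proof
      show "compact U"
        unfolding U_def using VC(2)
        by (intro compact_Un compact_continuous_image continuous_intros)
      have "V \<subseteq> interior U"
        using VC(1,4) by (intro interior_maximal) (auto simp: U_def)
      then show "0 \<in> interior U" using VC(3) by blast
      show "- x \<in> U" if "x \<in> U" for x
        using that unfolding U_def by force
      show "continuous_on UNIV (\<lambda>x. complex_of_real (1 - f x))"
        by (intro continuous_intros cont)
      show "x \<in> U" if "complex_of_real (1 - f x) \<noteq> 0" for x
        using that f(3) VC(4) unfolding U_def by auto
      show "cmod (complex_of_real (1 - f x)) \<le> 1" for x
        unfolding norm_of_real using range[of x] by auto
      show "complex_of_real (1 - f 0) = 1"
        by (simp add: f(2))
    qed
  qed
qed

text \<open>A compact cover of least cardinality is infinite or a singleton, since a finite union of compact sets is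
  compact.\<close>

lemma card_of_cover_infinite:
  fixes Z :: "'g::t2_space set"
  assumes cover: "compact_cover (top_of_set Z) \<K>" and Z: "Z \<noteq> {}"
    and min: "\<And>\<L>. compact_cover (top_of_set Z) \<L> \<Longrightarrow> |\<K>| \<le>o |\<L>|" and ne: "\<not> |\<K>| =o cone"
  shows "infinite \<K>"
proof
  assume "finite \<K>"
  have K: "\<And>K. K \<in> \<K> \<Longrightarrow> compact K" "\<Union>\<K> = Z"
    using cover by (auto simp: compact_cover_def compactin_subtopology)
  then have "compact Z"
    using compact_Union[OF \<open>finite \<K>\<close>] by auto
  then have "compact_cover (top_of_set Z) {Z}"
    by (simp add: compact_cover_def compactin_subtopology)
  then have "|\<K>| \<le>o |{Z}|" by (rule min)
  moreover have "|{Z}| \<le>o |{()}|" "|{()}| \<le>o |\<K>|"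
    using K(2) Z by (auto intro!: card_of_singl_ordLeq)
  ultimately have "|\<K>| =o |{()}|"
    using ordLeq_transitive ordIso_iff_ordLeq by blast
  then show False using ne by (simp add: BNF_Cardinal_Arithmetic.cone_def)
qed

text \<open>Minimality of the cover is what leaves room for new generators: intersected with the closed
  centre, the translates of \<open>K\<close> are compact subsets of it, so fewer than \<open>|\<K>|\<close> of them miss a point.\<close>

lemma small_translates_not_cover:
  fixes \<K> :: "'g::{topological_group_add, t2_space} set set" and Q :: "'g center set"
  assumes min: "\<And>\<L>. compact_cover (top_of_set (group_center :: 'g set)) \<L> \<Longrightarrow> |\<K>| \<le>o |\<L>|"
    and K: "compact K" and Q: "|Q| <o |\<K>|"
  shows "\<exists>z. \<forall>q\<in>Q. center_elt (z - q) \<notin> K"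
proof (rule ccontr)
  assume "\<not> ?thesis"
  then have all: "\<exists>q\<in>Q. center_elt (z - q) \<in> K" for z by blast
  let ?T = "\<lambda>q. (\<lambda>x. x + center_elt q) ` K \<inter> group_center"
  have "compact_cover (top_of_set (group_center :: 'g set)) (?T ` Q)"
    unfolding compact_cover_def
  proof
    have "compact (?T q)" for q
      by (intro compact_Int_closed closed_group_center compact_continuous_image K continuous_intros)
    then show "\<forall>C\<in>?T ` Q. compactin (top_of_set group_center) C"
      by (auto simp: compactin_subtopology)
    have "z \<in> \<Union>(?T ` Q)" if "z \<in> group_center" for z
    proof -
      obtain q where q: "q \<in> Q" "center_elt (Center z - q) \<in> K"
        using all by blast
      have "z = center_elt (Center z - q) + center_elt q"
        using that by (simp add: minus_center.rep_eq Center_inverse)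
      then have "z \<in> ?T q" using q(2) that by blast
      then show ?thesis using q(1) by blast
    qed
    then show "\<Union>(?T ` Q) = topspace (top_of_set group_center)" by auto
  qed
  then have "|\<K>| \<le>o |?T ` Q|" by (rule min)
  then have "|\<K>| \<le>o |Q|" using card_of_image ordLeq_transitive by blast
  then show False using Q not_ordLess_ordLeq by blast
qed

text \<open>Any two central elements of \<open>U + g\<close> differ by an element of \<open>K = U + U + U + U\<close>, and a compact set
  is covered by finitely many of the sets \<open>U + g\<close>. So the finiteness that holds for sets with all
  differences in \<open>K\<close> extends to compact sets.\<close>

lemma separated_bumps_exist:
  fixes \<K> :: "'g::{topological_group_add, t2_space} set set"
  assumes "bump U h" and inf: "infinite \<K>"
    and min: "\<And>\<L>. compact_cover (top_of_set (group_center :: 'g set)) \<L> \<Longrightarrow> |\<K>| \<le>o |\<L>|"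
  obtains a b :: "'g set \<Rightarrow> nat \<Rightarrow> nat \<Rightarrow> 'g" where "separated_bumps U h (grid a b) (grid_index \<K>)"
proof -
  interpret bump U h by fact
  define K where "K = {p + q | p q. p \<in> UU \<and> q \<in> UU}"
  have K: "compact K"
    unfolding K_def by (rule compact_image2[OF UU_compact UU_compact])
      (auto simp: case_prod_unfold intro!: continuous_intros)
  have K_uminus: "- x \<in> K" if "x \<in> K" for x
  proof -
    obtain p q where "x = p + q" "p \<in> UU" "q \<in> UU" using \<open>x \<in> K\<close> unfolding K_def by blast
    then have "- x = - q + - p" "- q \<in> UU" "- p \<in> UU" by (auto simp: minus_add UU_uminus)
    then show ?thesis unfolding K_def by blast
  qed
  let ?K = "{z :: 'g center. center_elt z \<in> K}"
  have sym: "- x \<in> ?K" if "x \<in> ?K" for x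
    using that K_uminus by (simp add: uminus_center.rep_eq)
  have avoid: "\<exists>z. \<forall>q\<in>Q. z - q \<notin> ?K" if "|Q| <o |\<K>|" for Q
    using small_translates_not_cover[OF min K that] by simp
  obtain a b :: "'g set \<Rightarrow> nat \<Rightarrow> nat \<Rightarrow> 'g center" where
    sep: "\<forall>l \<in> grid_index \<K>. \<forall>l' \<in> grid_index \<K>. l \<noteq> l' \<longrightarrow> grid a b l - grid a b l' \<notin> ?K"
    and fin: "\<forall>D. (\<forall>x\<in>D. \<forall>y\<in>D. x - y \<in> ?K) \<longrightarrow> finite {(l, l').
        l \<in> grid_index \<K> \<and> l' \<in> grid_index \<K> \<and> l \<noteq> l' \<and> grid a b l - grid a b l' \<in> D}"
    by (rule separated_grid_exists[OF inf sym avoid])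
  define a' b' where "a' = (\<lambda>i n k. center_elt (a i n k))" and "b' = (\<lambda>i n k. center_elt (b i n k))"
  have grid': "grid a' b' l = center_elt (grid a b l)" for l
    by (simp add: grid_def a'_def b'_def plus_center.rep_eq case_prod_unfold)
  have "separated_bumps U h (grid a' b') (grid_index \<K>)"
  proof
    show "grid a' b' l + x = x + grid a' b' l" for l x
      unfolding grid' by (rule center_elt_commute)
    show "grid a' b' l - grid a' b' l' \<noteq> p + q"
      if "l \<in> grid_index \<K>" "l' \<in> grid_index \<K>" "l \<noteq> l'" "p \<in> UU" "q \<in> UU" for l l' p q
    proof
      assume "grid a' b' l - grid a' b' l' = p + q"
      then have "grid a b l - grid a b l' \<in> ?K"
        using that(4,5) by (auto simp: grid' minus_center.rep_eq K_def)
      then show False using sep that(1-3) by blast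
    qed
  next
    fix C :: "'g set" assume "compact C"
    let ?P = "\<lambda>D. {(l, l'). l \<in> grid_index \<K> \<and> l' \<in> grid_index \<K> \<and> l \<noteq> l' \<and> grid a b l - grid a b l' \<in> D}"
    let ?V = "\<lambda>g :: 'g. {x. x - g \<in> interior U}"
    let ?D = "\<lambda>g. {z. center_elt z \<in> ?V g}"
    have "open (?V g)" for g
      by (rule open_right_shift) simp
    moreover have "C \<subseteq> \<Union>(?V ` C)"
      using U_nhd by auto
    ultimately obtain F where F: "F \<subseteq> C" "finite F" "C \<subseteq> \<Union>(?V ` F)"
      using compactE_image[OF \<open>compact C\<close>, of C ?V] by auto
    have "finite (?P (?D g))" for g
    proof (rule fin[rule_format])
      fix x y assume "x \<in> ?D g" "y \<in> ?D g"
      then have xy: "center_elt x - g \<in> U" "center_elt y - g \<in> U"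
        using interior_subset by blast+
      have "(center_elt x - g) + - (center_elt y - g) + 0 \<in> K"
        unfolding K_def using UU_I[OF xy(1) U_uminus[OF xy(2)]] UU_sub[OF U_0] by blast
      moreover have "(center_elt x - g) + - (center_elt y - g) + 0 = center_elt (x - y)"
        unfolding minus_center.rep_eq by (simp only: group_word_simps)
      ultimately show "x - y \<in> ?K" by simp
    qed
    then have "finite (\<Union>g\<in>F. ?P (?D g))"
      using F(2) by blast
    moreover have "{(l, l'). l \<in> grid_index \<K> \<and> l' \<in> grid_index \<K> \<and> l \<noteq> l' \<and> grid a' b' l - grid a' b' l' \<in> C}
        \<subseteq> (\<Union>g\<in>F. ?P (?D g))"
    proof
      fix p assume p: "p \<in> {(l, l'). l \<in> grid_index \<K> \<and> l' \<in> grid_index \<K> \<and> l \<noteq> l' \<and> grid a' b' l - grid a' b' l' \<in> C}"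
      obtain l l' where ll': "p = (l, l')" by (cases p)
      have C: "center_elt (grid a b l - grid a b l') \<in> C"
        using p by (simp add: ll' grid' minus_center.rep_eq)
      then obtain g where "g \<in> F" "center_elt (grid a b l - grid a b l') \<in> ?V g"
        using F(3) by blast
      moreover from this have "p \<in> ?P (?D g)"
        using p by (simp add: ll')
      ultimately show "p \<in> (\<Union>g\<in>F. ?P (?D g))" by (rule_tac UN_I)
    qed
    ultimately show "finite {(l, l'). l \<in> grid_index \<K> \<and> l' \<in> grid_index \<K> \<and> l \<noteq> l' \<and>
        grid a' b' l - grid a' b' l' \<in> C}"
      by (rule rev_finite_subset)
  qed
  then show thesis by (rule that)
qed

lemma cmod_le_linfty_norm:
  assumes "x \<in> linfty I"
  shows "cmod (x i) \<le> linfty_norm x"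
proof -
  have "bounded (range (\<lambda>i. cmod (x i)))"
    using assms unfolding linfty_def bounded_iff by auto
  then show ?thesis
    unfolding linfty_norm_def by (intro cSUP_upper bounded_imp_bdd_above) auto
qed

theorem theorem5p4:
  fixes \<kappa> :: "'g::{topological_group_add, t2_space} set rel"
  assumes "locally_compact_space (euclidean :: 'g topology)"
    and "\<kappa> = compact_covering_number (subtopology euclidean (group_center :: 'g set))"
    and "\<not> \<kappa> =o cone"
  shows "\<exists>\<Psi> :: ('g set \<Rightarrow> complex) \<Rightarrow> ('g \<Rightarrow>\<^sub>C complex) set.
     (\<forall>x \<in> linfty (Field \<kappa>). \<Psi> x \<in> quotient_space WAP Eberlein) \<and>
     (\<forall>x \<in> linfty (Field \<kappa>). \<forall>y \<in> linfty (Field \<kappa>). \<Psi> (\<lambda>i. x i + y i) = \<Psi> x + \<Psi> y) \<and>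
     (\<forall>c. \<forall>x \<in> linfty (Field \<kappa>). \<Psi> (\<lambda>i. c * x i) = quotient_scale Eberlein c (\<Psi> x)) \<and>
     (\<forall>x \<in> linfty (Field \<kappa>). quotient_norm (\<Psi> x) = linfty_norm x)"
proof -
  obtain \<K> where \<K>: "compact_cover (top_of_set (group_center :: 'g set)) \<K>" "\<kappa> = |\<K>|"
    using compact_covering_number_attained assms(2) by blast
  have min: "|\<K>| \<le>o |\<L>|" if "compact_cover (top_of_set (group_center :: 'g set)) \<L>" for \<L>
    using compact_covering_number_le[OF that] \<K>(2) assms(2) by simp
  have Field: "Field \<kappa> = \<K>"
    by (simp add: \<K>(2) Field_card_of)
  have "(0 :: 'g) \<in> group_center" by (simp add: group_center_def)
  then have "infinite \<K>"
    using card_of_cover_infinite[OF \<K>(1) _ min] assms(3) \<K>(2) by blast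
  obtain U h where "bump U (h :: 'g \<Rightarrow> complex)"
    using symmetric_bump_exists[OF assms(1)] by blast
  then obtain a b where "separated_bumps U h (grid a b) (grid_index \<K>)"
    using separated_bumps_exist[OF _ \<open>infinite \<K>\<close> min] by blast
  then interpret separated_bumps U h "grid a b" "grid_index \<K>" .
  define coeff :: "('g set \<Rightarrow> complex) \<Rightarrow> 'g set \<times> nat \<times> nat \<times> nat \<Rightarrow> complex"
    where "coeff x = (\<lambda>(i, n, p, q). x i * fourier_matrix n p q)" for x
  define \<Psi> where "\<Psi> x = bump_series (coeff x) +o (Eberlein :: ('g \<Rightarrow>\<^sub>C complex) set)" for x
  have coeff_le: "cmod (coeff x l) \<le> linfty_norm x" if "x \<in> linfty \<K>" for x l
    using cmod_le_linfty_norm[OF that] by (simp add: coeff_def case_prod_unfold norm_mult)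
  have "\<Psi> x \<in> quotient_space WAP Eberlein" if x: "x \<in> linfty \<K>" for x
    unfolding \<Psi>_def quotient_space_def
    by (rule imageI, rule bump_series_in_WAP[of "coeff x", OF coeff_le[OF x]])
  moreover have "\<Psi> (\<lambda>i. x i + y i) = \<Psi> x + \<Psi> y" if x: "x \<in> linfty \<K>" and y: "y \<in> linfty \<K>" for x y
  proof -
    have "coeff (\<lambda>i. x i + y i) = (\<lambda>l. coeff x l + coeff y l)"
      by (auto simp: coeff_def distrib_right)
    then show ?thesis
      unfolding \<Psi>_def coset_add[OF Eberlein_subspace]
      using bump_series_add[of "coeff x" _ "coeff y", OF coeff_le[OF x] coeff_le[OF y]] by simp
  qed
  moreover have "\<Psi> (\<lambda>i. c * x i) = quotient_scale Eberlein c (\<Psi> x)" if x: "x \<in> linfty \<K>" for c x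
  proof -
    have "coeff (\<lambda>i. c * x i) = (\<lambda>l. c * coeff x l)"
      by (auto simp: coeff_def mult.assoc)
    then show ?thesis
      unfolding \<Psi>_def quotient_scale_coset[OF Eberlein_subspace]
      using bump_series_scale[of "coeff x", OF coeff_le[OF x]] by simp
  qed
  moreover have "quotient_norm (\<Psi> x) = linfty_norm x" if x: "x \<in> linfty \<K>" for x
  proof (rule antisym)
    let ?f = "bump_series (coeff x)"
    have "?f + 0 \<in> \<Psi> x"
      unfolding \<Psi>_def by (rule set_plus_intro2, rule bcf.subspace_0[OF Eberlein_subspace])
    then have f: "?f \<in> \<Psi> x" by simp
    have "quotient_norm (\<Psi> x) \<le> norm ?f"
      unfolding quotient_norm_def by (rule cINF_lower[OF _ f]) (auto intro: bdd_belowI2[where m = 0])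
    also have "\<dots> \<le> linfty_norm x"
      by (rule norm_bump_series_le[of "coeff x", OF coeff_le[OF x]])
    finally show "quotient_norm (\<Psi> x) \<le> linfty_norm x" .
    show "linfty_norm x \<le> quotient_norm (\<Psi> x)"
      unfolding quotient_norm_def
    proof (rule cINF_greatest)
      show "\<Psi> x \<noteq> {}" using f by blast
      fix g assume "g \<in> \<Psi> x"
      then obtain w where w: "w \<in> Eberlein" "g = ?f + w"
        unfolding \<Psi>_def elt_set_plus_def by blast
      show "linfty_norm x \<le> norm g"
        unfolding linfty_norm_def
      proof (rule cSUP_least)
        fix i
        show "cmod (x i) \<le> norm g"
        proof (cases "i \<in> \<K>")
          case True
          have "?f (a i n p + b i n q) = x i * fourier_matrix n p q" if "p < n" "q < n" for n p q
          proof -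
            have "?f (grid a b (i, n, p, q)) = coeff x (i, n, p, q)"
              unfolding apply_bump_series[of "coeff x", OF coeff_le[OF x]]
              by (rule bump_sum_center) (use True that in \<open>simp add: grid_index_def\<close>)
            then show ?thesis by (simp add: grid_def coeff_def)
          qed
          then show ?thesis unfolding w(2) by (rule Eberlein_distance[OF _ w(1)])
        next
          case False
          then show ?thesis using x by (simp add: linfty_def)
        qed
      qed simp
    qed
  qed
  ultimately show ?thesis
    unfolding Field by (intro exI[of _ \<Psi>]) blast
qed

end
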